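(* Let $(\widetilde H/\widetilde K,\widetilde P)$ be a flat $2$-reductive $\widetilde G$-structure and $\pi:P\to M$ a $G$-structure with $G\simeq G_\sharp/N_\sharp$. Let $(s,\omega^0)$ and $(s',\omega'^0)$ be two strongly equivalent admissible tuples of $P$ on an open set $\mathcal U\subset M$, and let $\mathcal R$ and $\mathcal R'$ be the associated maps $$\mathcal R:\mathcal A_{(s,\omega^0)}\to\mathcal C^\infty(\mathcal U,Z^{2,2}(\widetilde{\mathfrak h},W)),\ \ \mathcal R((s,\omega^0,\omega^1))=\Omega^1,\qquad \mathcal R':\mathcal A_{(s',\omega'^0)}\to\mathcal C^\infty(\mathcal U,Z^{2,2}(\widetilde{\mathfrak h},W)),\ \ \mathcal R'((s',\omega'^0,\omega'^1))=\Omega'^1 .$$ Then $$\mathcal R(\mathcal A_{(s,\omega^0)})=\mathcal R'(\mathcal A_{(s',\omega'^0)}).$$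
   Context: All objects are smooth. For a closed subgroup $G\subset\mathrm{GL}_n(\mathbb R)$, a $G$-structure on an $n$-manifold $M$ is a $G$-reduction $\pi:P\to M$ of the linear frame bundle $L(M)$; its soldering form $\vartheta=(\vartheta^1,\dots,\vartheta^n)$ assigns to $v\in T_uP$ the components of $\pi_*v$ in the frame $u$. Flat $2$-reductive structures. $\widetilde M=\widetilde H/\widetilde K$ is a homogeneous manifold of dimension $\widetilde n\ge n$ with effective action, $\widetilde H$ connected and simply connected, $\widetilde K$ connected, $o=e\widetilde K$; $u_o$ is a fixed frame at $o$, identifying $T_o\widetilde M=\widetilde{\mathfrak h}/\widetilde{\mathfrak k}$ with $\mathbb R^{\widetilde n}$ (where $\widetilde{\mathfrak h}=Lie(\widetilde H)$, $\widetilde{\mathfrak k}=Lie(\widetilde K)$); $\widetilde P=\widetilde H\cdot u_o\subset L(\widetilde M)$, with structure group $\widetilde G\subset\mathrm{GL}_{\widetilde n}(\mathbb R)$ equal to the image of the isotropy representation of $\widetilde K$. It is flat $2$-reductive if $\widetilde{\mathfrak h}=\widetilde{\mathfrak h}^{-1}+\widetilde{\mathfrak h}^0+\widetilde{\mathfrak h}^1$ is a graded Lie algebra ($[\widetilde{\mathfrak h}^r,\widetilde{\mathfrak h}^s]\subset\widetilde{\mathfrak h}^{r+s}$, with $\widetilde{\mathfrak h}^p=0$ if $p\notin\{-1,0,1\}$) and $\widetilde{\mathfrak k}=\widetilde{\mathfrak h}^0+\widetilde{\mathfrak h}^1$. Put $V=\mathbb R^{\widetilde n}\simeq\widetilde{\mathfrak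 h}^{-1}$ and let $W\simeq\mathbb R^n\subset V$ be the subspace where the last $\widetilde n-n$ coordinates vanish. $G_\sharp\subset\widetilde G$ is the subgroup of block matrices $\begin{pmatrix}A&B\\0&D\end{pmatrix}\in\widetilde G$ with $A$ of size $n\times n$, and $N_\sharp$ its normal subgroup of those with $A=I$. $G\simeq G_\sharp/N_\sharp$ means that $G$ is the group of upper left blocks $A$ of elements of $G_\sharp$. Conventions: $[\alpha,\beta](X,Y)=[\alpha(X),\beta(Y)]-[\alpha(Y),\beta(X)]$ for $1$-forms, and $[\alpha,\varpi](X)=[\alpha(X),\varpi]$ for a $1$-form $\alpha$ and a function $\varpi$. Admissible tuples. For a section $s:\mathcal U\to P$ over an open $\mathcal U\subset M$ put $\omega^{-1}=(s^*\vartheta^1,\dots,s^*\vartheta^n,0,\dots,0)$, an $\widetilde{\mathfrak h}^{-1}$-valued $1$-form. A tuple $(s,\omega^0)$, with $\omega^0$ an $\widetilde{\mathfrak h}^0$-valued $1$-form on $\mathcal U$, is admissible if $d\omega^{-1}=-[\omega^{-1},\omega^0]$. A tuple $(s,\omega^0,\omega^1)$, with moreover $\omega^1$ an $\widetilde{\mathfrak h}^1$-valued $1$-form, is admissible if in addition $d\omega^0+\frac12[\omega^0,\omega^0]=-[\omega^{-1},\omega^1]$. Its total curvature is $\Omega^1=d\omega^1+[\omega^0,\omega^1]$, an $\widetilde{\mathfrak h}^1$-valued $2$-form. Two admissible tuples $(s,\omega^0)$ and $(s',\omega'^0)$ on the same $\mathcal U$ are strongly equivalent if $s=s'$ and $\omega'^0=\omega^0+[\omega^{-1},\varpi^1]$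 for some $\widetilde{\mathfrak h}^1$-valued function $\varpi^1$ on $\mathcal U$. $\mathcal A_{(s,\omega^0)}$ denotes the set of all admissible tuples of the form $(s,\omega^0,\omega^1)$ with the given first two entries $s$ and $\omega^0$. Cocycles. $Z^{2,2}(\widetilde{\mathfrak h},W)$ is the space of $c\in\widetilde{\mathfrak h}^1\otimes\Lambda^2W^*$ with $\partial c=0$, where $\partial c(w_1,w_2,w_3)=\sum_{i=1}^3(-1)^i[c(\dots,\widehat{w_i},\dots),w_i]\in\widetilde{\mathfrak h}^0$. The $2$-form $\Omega^1$ is regarded as a map into $Z^{2,2}(\widetilde{\mathfrak h},W)$ by identifying $T_xM$ with $W=\mathbb R^n$ by means of the frame $s_x$. *)

theory Defs
  imports "HOL-Analysis.Analysis" "HOL-Algebra.Group_Action"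
begin

section \<open>Smooth manifolds\<close>

fun Ck_on :: "nat \<Rightarrow> 'a::real_normed_vector set \<Rightarrow> ('a \<Rightarrow> 'b::real_normed_vector) \<Rightarrow> bool" where
  "Ck_on 0 S f \<longleftrightarrow> continuous_on S f"
| "Ck_on (Suc k) S f \<longleftrightarrow> (\<forall>x\<in>S. f differentiable (at x)) \<and>
     (\<forall>v. Ck_on k S (\<lambda>x. frechet_derivative f (at x) v))"

text \<open>Only used for open \<open>S\<close> in a finite-dimensional space, where this is \<open>C\<^sup>\<infinity>\<close>.\<close>

definition smooth_on :: "'a::real_normed_vector set \<Rightarrow> ('a \<Rightarrow> 'b::real_normed_vector) \<Rightarrow> bool" where
  "smooth_on S f \<longleftrightarrow> (\<forall>k. Ck_on k S f)"

text \<open>A chart is a domain with a coordinate map, whose values off the domain are irrelevant.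
  A smooth structure is given by an arbitrary (not necessarily maximal) atlas.\<close>

type_synonym ('m, 'e) chart = "'m set \<times> ('m \<Rightarrow> 'e)"

abbreviation chart_inv :: "('m, 'e) chart \<Rightarrow> 'e \<Rightarrow> 'm" where
  "chart_inv c \<equiv> inv_into (fst c) (snd c)"

definition smooth_manifold ::
  "('m::{t2_space,second_countable_topology}, 'e::euclidean_space) chart set \<Rightarrow> bool" where
  "smooth_manifold A \<longleftrightarrow> (\<Union>c\<in>A. fst c) = UNIV \<and>
     (\<forall>c\<in>A. open (fst c) \<and> open (snd c ` fst c) \<and>
        homeomorphism (fst c) (snd c ` fst c) (snd c) (chart_inv c)) \<and>
     (\<forall>c\<in>A. \<forall>d\<in>A. smooth_on (snd c ` (fst c \<inter> fst d)) (snd d \<circ> chart_inv c))"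

text \<open>The target of a smooth map is only seen through its charts (continuity is expressed by
  the openness of the preimages of the chart domains), so that no topology has to be put on
  the type of frames.\<close>

definition smooth_map_on :: "'m::topological_space set \<Rightarrow> ('m, 'e::euclidean_space) chart set \<Rightarrow>
    ('p, 'f::euclidean_space) chart set \<Rightarrow> ('m \<Rightarrow> 'p) \<Rightarrow> bool" where
  "smooth_map_on U A B f \<longleftrightarrow> f ` U \<subseteq> (\<Union>d\<in>B. fst d) \<and>
     (\<forall>d\<in>B. open (U \<inter> f -` fst d) \<and>
        (\<forall>c\<in>A. smooth_on (snd c ` (fst c \<inter> U \<inter> f -` fst d)) (snd d \<circ> f \<circ> chart_inv c)))"

definition eucl_atlas :: "('e, 'e) chart set" where
  "eucl_atlas = {(UNIV, \<lambda>x. x)}"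

definition prod_atlas :: "('m, 'e) chart set \<Rightarrow> ('p, 'f) chart set \<Rightarrow> ('m \<times> 'p, 'e \<times> 'f) chart set"
  where "prod_atlas A B = {(fst c \<times> fst d, \<lambda>(x, y). (snd c x, snd d y)) |c d. c \<in> A \<and> d \<in> B}"

definition chart_at :: "('m, 'e) chart set \<Rightarrow> 'm \<Rightarrow> ('m, 'e) chart" where
  "chart_at A x = (SOME c. c \<in> A \<and> x \<in> fst c)"

text \<open>A tangent vector at \<open>x\<close> is the family of its coordinate vectors in all charts around
  \<open>x\<close>, related by the derivatives of the transition maps (and \<open>0\<close> on everything that is not a
  chart around \<open>x\<close>). Its vector space operations are the pointwise ones.\<close>

type_synonym ('m, 'e) tvec = "('m, 'e) chart \<Rightarrow> 'e"

definition tangent_space ::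
  "('m, 'e::euclidean_space) chart set \<Rightarrow> 'm \<Rightarrow> ('m, 'e) tvec set" where
  "tangent_space A x = {X.
     (\<forall>c\<in>A. \<forall>d\<in>A. x \<in> fst c \<longrightarrow> x \<in> fst d \<longrightarrow>
        X d = frechet_derivative (snd d \<circ> chart_inv c) (at (snd c x)) (X c)) \<and>
     (\<forall>c. \<not> (c \<in> A \<and> x \<in> fst c) \<longrightarrow> X c = 0)}"

text \<open>The tangent vector at \<open>x\<close> with coordinates \<open>\<xi>\<close> in the chart \<open>c\<close>.\<close>

definition coord_vec :: "('m, 'e::euclidean_space) chart set \<Rightarrow> ('m, 'e) chart \<Rightarrow> 'm \<Rightarrow> 'e \<Rightarrow>
    ('m, 'e) tvec" where
  "coord_vec A c x \<xi> = (\<lambda>d. if d \<in> A \<and> x \<in> fst d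
     then frechet_derivative (snd d \<circ> chart_inv c) (at (snd c x)) \<xi> else 0)"

text \<open>The differential of \<open>f\<close> at \<open>x\<close>; the choice of the chart around \<open>x\<close> is immaterial.\<close>

definition tangent_map :: "('m, 'e::euclidean_space) chart set \<Rightarrow>
    ('p, 'f::euclidean_space) chart set \<Rightarrow> ('m \<Rightarrow> 'p) \<Rightarrow> 'm \<Rightarrow> ('m, 'e) tvec \<Rightarrow> ('p, 'f) tvec" where
  "tangent_map A B f x X = (let c = chart_at A x in
     (\<lambda>d. if d \<in> B \<and> f x \<in> fst d
       then frechet_derivative (snd d \<circ> f \<circ> chart_inv c) (at (snd c x)) (X c) else 0))"


section \<open>Vector fields and differential forms\<close>

definition smooth_vector_field ::
  "('m, 'e::euclidean_space) chart set \<Rightarrow> ('m \<Rightarrow> ('m, 'e) tvec) \<Rightarrow> bool" where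
  "smooth_vector_field A X \<longleftrightarrow> (\<forall>x. X x \<in> tangent_space A x) \<and>
     (\<forall>c\<in>A. smooth_on (snd c ` fst c) (\<lambda>y. X (chart_inv c y) c))"

definition vf_bracket :: "('m, 'e::euclidean_space) chart set \<Rightarrow> ('m \<Rightarrow> ('m, 'e) tvec) \<Rightarrow>
    ('m \<Rightarrow> ('m, 'e) tvec) \<Rightarrow> 'm \<Rightarrow> ('m, 'e) tvec" where
  "vf_bracket A X Y x = (\<lambda>c. if c \<in> A \<and> x \<in> fst c
     then frechet_derivative (\<lambda>y. Y (chart_inv c y) c) (at (snd c x)) (X x c)
        - frechet_derivative (\<lambda>y. X (chart_inv c y) c) (at (snd c x)) (Y x c)
     else 0)"

type_synonym ('m, 'e, 'v) form1 = "'m \<Rightarrow> ('m, 'e) tvec \<Rightarrow> 'v"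
type_synonym ('m, 'e, 'v) form2 = "'m \<Rightarrow> ('m, 'e) tvec \<Rightarrow> ('m, 'e) tvec \<Rightarrow> 'v"

text \<open>Smooth 1-forms on the open set \<open>U\<close> with values in the subspace \<open>S\<close>.\<close>

definition smooth_form1 :: "('m, 'e::euclidean_space) chart set \<Rightarrow> 'm set \<Rightarrow>
    'v::euclidean_space set \<Rightarrow> ('m, 'e, 'v) form1 \<Rightarrow> bool" where
  "smooth_form1 A U S \<alpha> \<longleftrightarrow>
     (\<forall>x\<in>U. \<forall>X\<in>tangent_space A x. \<alpha> x X \<in> S) \<and>
     (\<forall>x\<in>U. \<forall>X\<in>tangent_space A x. \<forall>Y\<in>tangent_space A x. \<forall>a b.
        \<alpha> x (\<lambda>c. a *\<^sub>R X c + b *\<^sub>R Y c) = a *\<^sub>R \<alpha> x X + b *\<^sub>R \<alpha> x Y) \<and>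
     (\<forall>c\<in>A. \<forall>\<xi>. smooth_on (snd c ` (fst c \<inter> U))
        (\<lambda>y. \<alpha> (chart_inv c y) (coord_vec A c (chart_inv c y) \<xi>)))"

text \<open>Normalised so that \<open>d\<alpha>(X,Y) = X(\<alpha>(Y)) - Y(\<alpha>(X)) - \<alpha>([X,Y])\<close>, computed with the
  coordinate fields that extend the two vectors; independent of the chart.\<close>

definition ext_deriv :: "('m, 'e::euclidean_space) chart set \<Rightarrow>
    ('m, 'e, 'v::real_normed_vector) form1 \<Rightarrow> ('m, 'e, 'v) form2" where
  "ext_deriv A \<alpha> x X Y = (let c = chart_at A x;
       a = (\<lambda>\<xi> y. \<alpha> (chart_inv c y) (coord_vec A c (chart_inv c y) \<xi>))
     in frechet_derivative (a (Y c)) (at (snd c x)) (X c)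
      - frechet_derivative (a (X c)) (at (snd c x)) (Y c))"

definition form_bracket :: "('v \<Rightarrow> 'v \<Rightarrow> 'v::real_vector) \<Rightarrow> ('m, 'e, 'v) form1 \<Rightarrow>
    ('m, 'e, 'v) form1 \<Rightarrow> ('m, 'e, 'v) form2" where
  "form_bracket br \<alpha> \<beta> x X Y = br (\<alpha> x X) (\<beta> x Y) - br (\<alpha> x Y) (\<beta> x X)"


section \<open>Frame bundles and \<open>G\<close>-structures\<close>

text \<open>A frame at \<open>x\<close> is a linear isomorphism from \<open>\<real>\<^sup>n\<close> onto the tangent space.\<close>

type_synonym ('m, 'n) frame = "real^'n \<Rightarrow> ('m, real^'n) tvec"

definition frame_bundle ::
  "('m, real^'n::finite) chart set \<Rightarrow> ('m \<times> ('m, 'n) frame) set" where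
  "frame_bundle A = {(x, u). (\<forall>c. linear (\<lambda>\<xi>. u \<xi> c)) \<and> bij_betw u UNIV (tangent_space A x)}"

definition frame_atlas :: "('m, real^'n::finite) chart set \<Rightarrow>
    ('m \<times> ('m, 'n) frame, (real^'n) \<times> (real^'n^'n)) chart set" where
  "frame_atlas A = {({(x, u) \<in> frame_bundle A. x \<in> fst c},
     \<lambda>(x, u). (snd c x, matrix (\<lambda>\<xi>. u \<xi> c))) |c. c \<in> A}"

definition closed_subgroup_GL :: "(real^'n^'n::finite) set \<Rightarrow> bool" where
  "closed_subgroup_GL G \<longleftrightarrow> closedin (top_of_set {A. invertible A}) G \<and> mat 1 \<in> G \<and>
     (\<forall>A\<in>G. \<forall>B\<in>G. A ** B \<in> G) \<and> (\<forall>A\<in>G. matrix_inv A \<in> G)"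

definition smooth_section :: "('m::topological_space, real^'n::finite) chart set \<Rightarrow>
    ('m \<times> ('m, 'n) frame) set \<Rightarrow> 'm set \<Rightarrow> ('m \<Rightarrow> 'm \<times> ('m, 'n) frame) \<Rightarrow> bool" where
  "smooth_section A P U s \<longleftrightarrow> smooth_map_on U A (frame_atlas A) s \<and>
     (\<forall>x\<in>U. s x \<in> P \<and> fst (s x) = x)"

text \<open>A \<open>G\<close>-reduction: the fibres are orbits of the right action \<open>(u, a) \<mapsto> u \<circ> a\<close>
  of \<open>G\<close>, and there are smooth local sections.\<close>

definition g_structure :: "('m::topological_space, real^'n::finite) chart set \<Rightarrow>
    (real^'n^'n) set \<Rightarrow> ('m \<times> ('m, 'n) frame) set \<Rightarrow> bool" where
  "g_structure A G P \<longleftrightarrow> closed_subgroup_GL G \<and> P \<subseteq> frame_bundle A \<and>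
     (\<forall>(x, u)\<in>P. {u'. (x, u') \<in> P} = {u \<circ> (*v) a |a. a \<in> G}) \<and>
     (\<forall>x. \<exists>U s. open U \<and> x \<in> U \<and> smooth_section A P U s)"

text \<open>The soldering form: the components of \<open>\<pi>\<^sub>* v\<close> in the frame \<open>u\<close>, for \<open>v\<close> tangent to the
  bundle at \<open>u\<close>. It is defined on all of the frame bundle; that of a reduction \<open>P\<close> is its
  restriction.\<close>

definition soldering ::
  "('m, real^'n::finite) chart set \<Rightarrow> 'm \<times> ('m, 'n) frame \<Rightarrow>
    ('m \<times> ('m, 'n) frame, (real^'n) \<times> (real^'n^'n)) tvec \<Rightarrow> real^'n" where
  "soldering A u v = inv_into UNIV (snd u) (tangent_map (frame_atlas A) A fst u v)"

definition pullback_soldering :: "('m, real^'n::finite) chart set \<Rightarrow>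
    ('m \<Rightarrow> 'm \<times> ('m, 'n) frame) \<Rightarrow> ('m, real^'n, real^'n) form1" where
  "pullback_soldering A s x X = soldering A (s x) (tangent_map A (frame_atlas A) s x X)"


section \<open>Lie groups and homogeneous manifolds\<close>

definition lie_group :: "'h::{t2_space,second_countable_topology} monoid \<Rightarrow>
    ('h, 'd::euclidean_space) chart set \<Rightarrow> bool" where
  "lie_group H AH \<longleftrightarrow> group H \<and> carrier H = UNIV \<and> smooth_manifold AH \<and>
     smooth_map_on UNIV (prod_atlas AH AH) AH (\<lambda>(g, h). g \<otimes>\<^bsub>H\<^esub> h) \<and>
     smooth_map_on UNIV AH AH (\<lambda>g. inv\<^bsub>H\<^esub> g)"

definition left_invariant_fields :: "'h monoid \<Rightarrow> ('h, 'd::euclidean_space) chart set \<Rightarrow>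
    ('h \<Rightarrow> ('h, 'd) tvec) set" where
  "left_invariant_fields H AH = {X. smooth_vector_field AH X \<and>
     (\<forall>g h. tangent_map AH AH (\<lambda>k. g \<otimes>\<^bsub>H\<^esub> k) h (X h) = X (g \<otimes>\<^bsub>H\<^esub> h))}"

definition lie_algebra :: "('l::real_vector \<Rightarrow> 'l \<Rightarrow> 'l) \<Rightarrow> bool" where
  "lie_algebra br \<longleftrightarrow> bilinear br \<and> (\<forall>a. br a a = 0) \<and>
     (\<forall>a b c. br a (br b c) + br b (br c a) + br c (br a b) = 0)"

text \<open>The space \<open>'l\<close> with the bracket \<open>br\<close> is identified with \<open>Lie(H)\<close>, the Lie algebra of
  left invariant vector fields, by means of \<open>\<Lambda>\<close>.\<close>

definition is_lie_algebra_of :: "'h monoid \<Rightarrow> ('h, 'd::euclidean_space) chart set \<Rightarrow>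
    ('l::euclidean_space \<Rightarrow> 'l \<Rightarrow> 'l) \<Rightarrow> ('l \<Rightarrow> 'h \<Rightarrow> ('h, 'd) tvec) \<Rightarrow> bool" where
  "is_lie_algebra_of H AH br \<Lambda> \<longleftrightarrow> lie_algebra br \<and>
     bij_betw \<Lambda> UNIV (left_invariant_fields H AH) \<and>
     (\<forall>g c. linear (\<lambda>a. \<Lambda> a g c)) \<and>
     (\<forall>a b. \<Lambda> (br a b) = vf_bracket AH (\<Lambda> a) (\<Lambda> b))"

text \<open>\<open>Lie(K)\<close> for a closed subgroup \<open>K\<close>: the initial velocities of the one-parameter
  subgroups lying in \<open>K\<close>.\<close>

definition lie_subalgebra :: "'h monoid \<Rightarrow> ('h, 'd::euclidean_space) chart set \<Rightarrow>
    ('l \<Rightarrow> 'h \<Rightarrow> ('h, 'd) tvec) \<Rightarrow> 'h set \<Rightarrow> 'l set" where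
  "lie_subalgebra H AH \<Lambda> K = {a. \<exists>\<gamma>::real \<Rightarrow> 'h. smooth_map_on UNIV eucl_atlas AH \<gamma> \<and>
     (\<forall>t t'. \<gamma> (t + t') = \<gamma> t \<otimes>\<^bsub>H\<^esub> \<gamma> t') \<and> range \<gamma> \<subseteq> K \<and>
     tangent_map eucl_atlas AH \<gamma> 0 (coord_vec eucl_atlas (UNIV, \<lambda>t. t) 0 1) = \<Lambda> a \<one>\<^bsub>H\<^esub>}"

text \<open>The homogeneous manifold \<open>H/K\<close>, given as a manifold with a smooth transitive effective
  action \<open>act\<close> of \<open>H\<close>; \<open>p\<close> is the base point \<open>o\<close> and \<open>K\<close> its stabilizer.\<close>

definition homogeneous_manifold :: "'h::{t2_space,second_countable_topology} monoid \<Rightarrow>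
    ('h, 'd::euclidean_space) chart set \<Rightarrow>
    ('p::{t2_space,second_countable_topology}, 'f::euclidean_space) chart set \<Rightarrow>
    ('h \<Rightarrow> 'p \<Rightarrow> 'p) \<Rightarrow> 'p \<Rightarrow> 'h set \<Rightarrow> bool" where
  "homogeneous_manifold H AH B act p K \<longleftrightarrow>
     lie_group H AH \<and> connected (UNIV::'h set) \<and> simply_connected (UNIV::'h set) \<and>
     smooth_manifold B \<and> transitive_action H UNIV act \<and> faithful_action H UNIV act \<and>
     smooth_map_on UNIV (prod_atlas AH B) B (\<lambda>(g, x). act g x) \<and>
     K = stabilizer H act p \<and> connected K"

text \<open>\<open>H \<sqdot> u\<^sub>o\<close>, with \<open>H\<close> acting on frames through the differentials of its action.\<close>

definition frame_orbit :: "('p, real^'N::finite) chart set \<Rightarrow> ('h \<Rightarrow> 'p \<Rightarrow> 'p) \<Rightarrow> 'p \<Rightarrow>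
    ('p, 'N) frame \<Rightarrow> ('p \<times> ('p, 'N) frame) set" where
  "frame_orbit B act p u = {(act g p, tangent_map B B (act g) p \<circ> u) |g. True}"

definition isotropy_matrices :: "('p, real^'N::finite) chart set \<Rightarrow> ('h \<Rightarrow> 'p \<Rightarrow> 'p) \<Rightarrow> 'p \<Rightarrow>
    'h set \<Rightarrow> ('p, 'N) frame \<Rightarrow> (real^'N^'N) set" where
  "isotropy_matrices B act p K u =
     {a. \<exists>k\<in>K. \<forall>v. tangent_map B B (act k) p (u v) = u (a *v v)}"


section \<open>Flat 2-reductive structures\<close>

definition graded_lie_algebra ::
  "('l::real_vector \<Rightarrow> 'l \<Rightarrow> 'l) \<Rightarrow> (int \<Rightarrow> 'l set) \<Rightarrow> bool" where
  "graded_lie_algebra br \<hh> \<longleftrightarrow> (\<forall>r. subspace (\<hh> r)) \<and> (\<forall>r. r \<notin> {-1, 0, 1} \<longrightarrow> \<hh> r = {0}) \<and>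
     (\<forall>a. \<exists>x\<in>\<hh> (-1). \<exists>y\<in>\<hh> 0. \<exists>z\<in>\<hh> 1. a = x + y + z) \<and>
     (\<forall>x\<in>\<hh> (-1). \<forall>y\<in>\<hh> 0. \<forall>z\<in>\<hh> 1. x + y + z = 0 \<longrightarrow> x = 0 \<and> y = 0 \<and> z = 0) \<and>
     (\<forall>r s. \<forall>x\<in>\<hh> r. \<forall>y\<in>\<hh> s. br x y \<in> \<hh> (r + s))"

text \<open>\<open>V \<simeq> \<hh>\<^sup>-\<^sup>1\<close> is the composite of the frame \<open>u\<close>, read as an isomorphism from \<open>V\<close> to
  \<open>T\<^sub>o(H/K) = \<hh>/\<kk>\<close>, with \<open>\<hh>/\<kk> \<simeq> \<hh>\<^sup>-\<^sup>1\<close>. Here \<open>\<hh> \<rightarrow> T\<^sub>o(H/K)\<close> is the differential at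
  the unit of the orbit map \<open>g \<mapsto> g \<sqdot> o\<close>.\<close>

definition frame_identification :: "'h monoid \<Rightarrow> ('h, 'd::euclidean_space) chart set \<Rightarrow>
    ('p, real^'N::finite) chart set \<Rightarrow> ('h \<Rightarrow> 'p \<Rightarrow> 'p) \<Rightarrow> 'p \<Rightarrow> ('p, 'N) frame \<Rightarrow>
    ('l::real_vector \<Rightarrow> 'h \<Rightarrow> ('h, 'd) tvec) \<Rightarrow> (int \<Rightarrow> 'l set) \<Rightarrow> (real^'N \<Rightarrow> 'l) \<Rightarrow> bool" where
  "frame_identification H AH B act p u \<Lambda> \<hh> \<phi> \<longleftrightarrow>
     linear \<phi> \<and> bij_betw \<phi> UNIV (\<hh> (-1)) \<and>
     (\<forall>v. tangent_map AH B (\<lambda>g. act g p) \<one>\<^bsub>H\<^esub> (\<Lambda> (\<phi> v) \<one>\<^bsub>H\<^esub>) = u v)"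

definition flat_2_reductive :: "'h::{t2_space,second_countable_topology} monoid \<Rightarrow>
    ('h, 'd::euclidean_space) chart set \<Rightarrow>
    ('l::euclidean_space \<Rightarrow> 'l \<Rightarrow> 'l) \<Rightarrow> ('l \<Rightarrow> 'h \<Rightarrow> ('h, 'd) tvec) \<Rightarrow> (int \<Rightarrow> 'l set) \<Rightarrow>
    ('p::{t2_space,second_countable_topology}, real^'N::finite) chart set \<Rightarrow>
    ('h \<Rightarrow> 'p \<Rightarrow> 'p) \<Rightarrow> 'p \<Rightarrow> 'h set \<Rightarrow> ('p, 'N) frame \<Rightarrow> (real^'N \<Rightarrow> 'l) \<Rightarrow>
    (real^'N^'N) set \<Rightarrow> ('p \<times> ('p, 'N) frame) set \<Rightarrow> bool" where
  "flat_2_reductive H AH br \<Lambda> \<hh> B act p K u \<phi> Gt Pt \<longleftrightarrow>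
     homogeneous_manifold H AH B act p K \<and>
     is_lie_algebra_of H AH br \<Lambda> \<and>
     graded_lie_algebra br \<hh> \<and>
     lie_subalgebra H AH \<Lambda> K = {y + z |y z. y \<in> \<hh> 0 \<and> z \<in> \<hh> 1} \<and>
     (p, u) \<in> frame_bundle B \<and>
     frame_identification H AH B act p u \<Lambda> \<hh> \<phi> \<and>
     Pt = frame_orbit B act p u \<and>
     Gt = isotropy_matrices B act p K u \<and>
     g_structure B Gt Pt"

text \<open>The index type \<open>'n\<close> of \<open>\<real>\<^sup>n\<close> is embedded in the index type \<open>'N\<close> of \<open>V\<close> by an injection
  \<open>\<iota>\<close>, whose range plays the role of the first \<open>n\<close> coordinates. \<open>W\<close> is the image of
  \<open>pad \<iota>\<close>.\<close>

definition pad :: "('n::finite \<Rightarrow> 'N::finite) \<Rightarrow> real^'n \<Rightarrow> real^'N" where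
  "pad \<iota> w = (\<chi> i. if i \<in> range \<iota> then w $ (inv_into UNIV \<iota> i) else 0)"

definition G_sharp :: "('n::finite \<Rightarrow> 'N::finite) \<Rightarrow> (real^'N^'N) set \<Rightarrow> (real^'N^'N) set" where
  "G_sharp \<iota> Gt = {a \<in> Gt. \<forall>i j. i \<notin> range \<iota> \<longrightarrow> a $ i $ (\<iota> j) = 0}"

definition upper_left :: "('n::finite \<Rightarrow> 'N::finite) \<Rightarrow> real^'N^'N \<Rightarrow> real^'n^'n" where
  "upper_left \<iota> a = (\<chi> i j. a $ (\<iota> i) $ (\<iota> j))"


section \<open>Admissible tuples\<close>

text \<open>In the following, \<open>j\<close> is the inclusion \<open>\<real>\<^sup>n \<simeq> W \<subseteq> V \<simeq> \<hh>\<^sup>-\<^sup>1\<close>.\<close>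

definition omega_minus :: "('m, real^'n::finite) chart set \<Rightarrow> (real^'n \<Rightarrow> 'l) \<Rightarrow>
    ('m \<Rightarrow> 'm \<times> ('m, 'n) frame) \<Rightarrow> ('m, real^'n, 'l) form1" where
  "omega_minus A j s x X = j (pullback_soldering A s x X)"

definition admissible2 :: "('m::topological_space, real^'n::finite) chart set \<Rightarrow>
    ('m \<times> ('m, 'n) frame) set \<Rightarrow> 'm set \<Rightarrow> ('l::euclidean_space \<Rightarrow> 'l \<Rightarrow> 'l) \<Rightarrow> (int \<Rightarrow> 'l set) \<Rightarrow>
    (real^'n \<Rightarrow> 'l) \<Rightarrow> ('m \<Rightarrow> 'm \<times> ('m, 'n) frame) \<times> ('m, real^'n, 'l) form1 \<Rightarrow> bool" where
  "admissible2 A P U br \<hh> j = (\<lambda>(s, \<omega>0).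
     smooth_section A P U s \<and> smooth_form1 A U (\<hh> 0) \<omega>0 \<and>
     (\<forall>x\<in>U. \<forall>X\<in>tangent_space A x. \<forall>Y\<in>tangent_space A x.
        ext_deriv A (omega_minus A j s) x X Y
          = - form_bracket br (omega_minus A j s) \<omega>0 x X Y))"

definition admissible3 :: "('m::topological_space, real^'n::finite) chart set \<Rightarrow>
    ('m \<times> ('m, 'n) frame) set \<Rightarrow> 'm set \<Rightarrow> ('l::euclidean_space \<Rightarrow> 'l \<Rightarrow> 'l) \<Rightarrow> (int \<Rightarrow> 'l set) \<Rightarrow>
    (real^'n \<Rightarrow> 'l) \<Rightarrow>
    ('m \<Rightarrow> 'm \<times> ('m, 'n) frame) \<times> ('m, real^'n, 'l) form1 \<times> ('m, real^'n, 'l) form1 \<Rightarrow> bool" where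
  "admissible3 A P U br \<hh> j = (\<lambda>(s, \<omega>0, \<omega>1).
     admissible2 A P U br \<hh> j (s, \<omega>0) \<and> smooth_form1 A U (\<hh> 1) \<omega>1 \<and>
     (\<forall>x\<in>U. \<forall>X\<in>tangent_space A x. \<forall>Y\<in>tangent_space A x.
        ext_deriv A \<omega>0 x X Y + (1/2) *\<^sub>R form_bracket br \<omega>0 \<omega>0 x X Y
          = - form_bracket br (omega_minus A j s) \<omega>1 x X Y))"

definition total_curvature :: "('m, real^'n::finite) chart set \<Rightarrow>
    ('l::euclidean_space \<Rightarrow> 'l \<Rightarrow> 'l) \<Rightarrow> ('m, real^'n, 'l) form1 \<Rightarrow> ('m, real^'n, 'l) form1 \<Rightarrow>
    ('m, real^'n, 'l) form2" where
  "total_curvature A br \<omega>0 \<omega>1 x X Y = ext_deriv A \<omega>1 x X Y + form_bracket br \<omega>0 \<omega>1 x X Y"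

text \<open>Sections and forms are total functions in HOL, so equality of those over \<open>U\<close> is
  pointwise equality over \<open>U\<close>.\<close>

definition strongly_equivalent :: "('m::topological_space, real^'n::finite) chart set \<Rightarrow>
    'm set \<Rightarrow> ('l::euclidean_space \<Rightarrow> 'l \<Rightarrow> 'l) \<Rightarrow> (int \<Rightarrow> 'l set) \<Rightarrow> (real^'n \<Rightarrow> 'l) \<Rightarrow>
    ('m \<Rightarrow> 'm \<times> ('m, 'n) frame) \<times> ('m, real^'n, 'l) form1 \<Rightarrow>
    ('m \<Rightarrow> 'm \<times> ('m, 'n) frame) \<times> ('m, real^'n, 'l) form1 \<Rightarrow> bool" where
  "strongly_equivalent A U br \<hh> j = (\<lambda>(s, \<omega>0) (s', \<omega>0').
     (\<forall>x\<in>U. s x = s' x) \<and>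
     (\<exists>\<pi>1. smooth_map_on U A eucl_atlas \<pi>1 \<and> (\<forall>x\<in>U. \<pi>1 x \<in> \<hh> 1) \<and>
        (\<forall>x\<in>U. \<forall>X\<in>tangent_space A x.
           \<omega>0' x X = \<omega>0 x X + br (omega_minus A j s x X) (\<pi>1 x))))"

definition admissible_extensions where
  "admissible_extensions A P U br \<hh> j s \<omega>0 =
     {(s, \<omega>0, \<omega>1) |\<omega>1. admissible3 A P U br \<hh> j (s, \<omega>0, \<omega>1)}"


section \<open>Cocycles and the curvature map\<close>

text \<open>Elements of \<open>\<Lambda>\<^sup>2 W\<^sup>*\<close> are written as alternating bilinear maps on \<open>\<real>\<^sup>n \<simeq> W\<close>.\<close>

definition coboundary :: "('l::real_vector \<Rightarrow> 'l \<Rightarrow> 'l) \<Rightarrow> ('w \<Rightarrow> 'l) \<Rightarrow> ('w \<Rightarrow> 'w \<Rightarrow> 'l) \<Rightarrow>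
    'w \<Rightarrow> 'w \<Rightarrow> 'w \<Rightarrow> 'l" where
  "coboundary br j c w1 w2 w3 = - br (c w2 w3) (j w1) + br (c w1 w3) (j w2) - br (c w1 w2) (j w3)"

definition Z22 :: "('l::real_vector \<Rightarrow> 'l \<Rightarrow> 'l) \<Rightarrow> (int \<Rightarrow> 'l set) \<Rightarrow> ('w::real_vector \<Rightarrow> 'l) \<Rightarrow>
    ('w \<Rightarrow> 'w \<Rightarrow> 'l) set" where
  "Z22 br \<hh> j = {c. bilinear c \<and> (\<forall>w. c w w = 0) \<and> (\<forall>w1 w2. c w1 w2 \<in> \<hh> 1) \<and>
     (\<forall>w1 w2 w3. coboundary br j c w1 w2 w3 = 0)}"

text \<open>Maps with domain \<open>U\<close> are extensional, so that their equality is equality on \<open>U\<close>.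
  \<open>Z\<close> is a finite-dimensional space of bilinear maps, so that smoothness can be tested on
  fixed arguments.\<close>

definition smooth_maps_to :: "('m::topological_space, 'e::euclidean_space) chart set \<Rightarrow> 'm set \<Rightarrow>
    ('w \<Rightarrow> 'w \<Rightarrow> 'l::euclidean_space) set \<Rightarrow> ('m \<Rightarrow> 'w \<Rightarrow> 'w \<Rightarrow> 'l) set" where
  "smooth_maps_to A U Z = {f \<in> (\<Pi>\<^sub>E x\<in>U. Z). \<forall>w1 w2. smooth_map_on U A eucl_atlas (\<lambda>x. f x w1 w2)}"

definition curvature_map :: "('m, real^'n::finite) chart set \<Rightarrow> 'm set \<Rightarrow>
    ('l::euclidean_space \<Rightarrow> 'l \<Rightarrow> 'l) \<Rightarrow>
    ('m \<Rightarrow> 'm \<times> ('m, 'n) frame) \<times> ('m, real^'n, 'l) form1 \<times> ('m, real^'n, 'l) form1 \<Rightarrow>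
    'm \<Rightarrow> real^'n \<Rightarrow> real^'n \<Rightarrow> 'l" where
  "curvature_map A U br = (\<lambda>(s, \<omega>0, \<omega>1). \<lambda>x\<in>U. \<lambda>w1 w2.
     total_curvature A br \<omega>0 \<omega>1 x (snd (s x) w1) (snd (s x) w2))"

end

theory Submission
  imports Defs
begin

text \<open>Strong equivalence is the gauge transformation \<open>\<omega> \<mapsto> Ad (exp (- \<pi>\<^sup>1)) \<omega> + d\<pi>\<^sup>1\<close> of the form
  \<open>\<omega> = \<omega>\<^sup>-\<^sup>1 + \<omega>\<^sup>0 + \<omega>\<^sup>1\<close>, seen in degrees -1 and 0. The grading truncates its degree 1 part to
  \<open>\<omega>'\<^sup>1 = \<omega>\<^sup>1 + d\<pi>\<^sup>1 + [\<omega>\<^sup>0, \<pi>\<^sup>1] + 1/2 [[\<omega>\<^sup>-\<^sup>1, \<pi>\<^sup>1], \<pi>\<^sup>1]\<close>. The curvature of an admissible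
  tuple has only its degree 1 component, which \<open>Ad (exp (- \<pi>\<^sup>1))\<close> fixes; so \<open>\<omega>\<^sup>1 \<mapsto> \<omega>'\<^sup>1\<close>
  maps admissible extensions to admissible extensions with the same total curvature. The cocycle
  condition is the Bianchi identity, i.e. the exterior derivative of the structure equation for
  \<open>\<omega>\<^sup>0\<close>.\<close>

section \<open>Calculus of smooth maps\<close>

text \<open>The factor 1/2 is the quadratic coefficient of exp D for D = [-, \<pi>1]: D raises the
  degree by one, so on degree -1 the terms of degree at most 1 end with D^2 / 2. Since the
  difference of the two degree 0 forms is the bracket of the degree -1 form with \<pi>1, both
  bracket terms of the new degree 1 form combine to 1/2 [\<omega>0 + \<omega>0', \<pi>1]. This
  version is used below because \<omega>0 and \<omega>0' are smooth by hypothesis, while the degree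
  -1 form is a pullback through the frame bundle, for which only differentiability is derived. The
  other obstacle is that \<open>ext_deriv\<close> picks a chart separately at each point. The
  Bianchi identity needs the structure equation for \<omega>0 on an open set in one fixed chart, so
  chart independence of the exterior derivative is established for smooth forms. The degree -1 form
  enters derivatives only to first order and at one point, where the chosen chart can be
  kept.\<close>

lemma frechet_derivative_cong_open:
  assumes "open S" "x \<in> S" "\<And>y. y \<in> S \<Longrightarrow> f y = g y"
  shows "frechet_derivative f (at x) = frechet_derivative g (at x)"
proof -
  \<comment> \<open>\<open>frechet_derivative\<close> is a choice among all derivatives; equal sets
    of candidates give equal choices, whether or not a derivative exists.\<close>
  have "(f has_derivative D) (at x) \<longleftrightarrow> (g has_derivative D) (at x)" for D
    using has_derivative_transform_within_open[OF _ assms(1,2), of _ _ UNIV] assms(3) by metis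
  then show ?thesis
    by (simp add: frechet_derivative_def)
qed

lemma differentiable_cong_open:
  assumes "open S" "x \<in> S" "\<And>y. y \<in> S \<Longrightarrow> f y = g y"
  shows "f differentiable (at x) \<longleftrightarrow> g differentiable (at x)"
  using has_derivative_transform_within_open[OF _ assms(1,2), of _ _ UNIV] assms(3)
  by (metis differentiable_def)

lemma Ck_on_cong:
  assumes "open S" "\<And>x. x \<in> S \<Longrightarrow> f x = g x"
  shows "Ck_on k S f \<longleftrightarrow> Ck_on k S g"
  using assms(2)
proof (induction k arbitrary: f g)
  case 0
  then show ?case by (simp cong: continuous_on_cong)
next
  case (Suc k)
  have "Ck_on k S (\<lambda>x. frechet_derivative f (at x) v) \<longleftrightarrow>
      Ck_on k S (\<lambda>x. frechet_derivative g (at x) v)" for v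
    by (rule Suc.IH) (simp add: frechet_derivative_cong_open[OF assms(1) _ Suc.prems])
  then show ?case
    using differentiable_cong_open[OF assms(1) _ Suc.prems] by auto
qed

lemma smooth_on_cong:
  assumes "open S" "\<And>x. x \<in> S \<Longrightarrow> f x = g x"
  shows "smooth_on S f \<longleftrightarrow> smooth_on S g"
  using Ck_on_cong[OF assms] by (simp add: smooth_on_def)

lemma Ck_on_subset: "Ck_on k S f \<Longrightarrow> T \<subseteq> S \<Longrightarrow> Ck_on k T f"
  by (induction k arbitrary: f) (auto intro: continuous_on_subset)

lemma smooth_on_subset: "smooth_on S f \<Longrightarrow> T \<subseteq> S \<Longrightarrow> smooth_on T f"
  by (auto simp: smooth_on_def intro: Ck_on_subset)

lemma Ck_on_Suc_imp: "Ck_on (Suc k) S f \<Longrightarrow> Ck_on k S f"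
proof (induction k arbitrary: f)
  case 0
  then show ?case
    by (metis Ck_on.simps differentiable_at_imp_differentiable_on differentiable_imp_continuous_on)
next
  case (Suc k)
  then show ?case by (metis Ck_on.simps(2))
qed

lemma smooth_on_imp_differentiable: "smooth_on S f \<Longrightarrow> x \<in> S \<Longrightarrow> f differentiable (at x)"
  unfolding smooth_on_def by (metis Ck_on.simps(2))

lemma smooth_on_frechet_derivative:
  "smooth_on S f \<Longrightarrow> smooth_on S (\<lambda>x. frechet_derivative f (at x) v)"
  unfolding smooth_on_def by (metis Ck_on.simps(2))

lemma Ck_on_const: "Ck_on k S (\<lambda>x. c)"
  by (induction k arbitrary: c) auto

lemma smooth_on_const: "smooth_on S (\<lambda>x. c)"
  by (simp add: smooth_on_def Ck_on_const)

lemma frechet_derivative_eqI: "(f has_derivative D) (at x) \<Longrightarrow> frechet_derivative f (at x) = D"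
  by (rule frechet_derivative_at[symmetric])

section \<open>Sum, linear and Leibniz rules for derivatives and for C^k maps\<close>

lemma frechet_derivative_add:
  "f differentiable (at x) \<Longrightarrow> g differentiable (at x) \<Longrightarrow>
    frechet_derivative (\<lambda>y. f y + g y) (at x) v =
      frechet_derivative f (at x) v + frechet_derivative g (at x) v"
  by (subst frechet_derivative_eqI[OF has_derivative_add])
    (auto simp: frechet_derivative_works)

lemma frechet_derivative_bounded_linear:
  "bounded_linear h \<Longrightarrow> f differentiable (at x) \<Longrightarrow>
    frechet_derivative (\<lambda>y. h (f y)) (at x) v = h (frechet_derivative f (at x) v)"
  by (subst frechet_derivative_eqI[OF bounded_linear.has_derivative])
    (auto simp: frechet_derivative_works)

lemma frechet_derivative_bounded_bilinear:
  "bounded_bilinear h \<Longrightarrow> f differentiable (at x) \<Longrightarrow> g differentiable (at x) \<Longrightarrow>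
    frechet_derivative (\<lambda>y. h (f y) (g y)) (at x) v =
      h (f x) (frechet_derivative g (at x) v) + h (frechet_derivative f (at x) v) (g x)"
  by (subst frechet_derivative_eqI[OF bounded_bilinear.FDERIV])
    (auto simp: frechet_derivative_works)

lemma differentiable_bounded_bilinear:
  "bounded_bilinear h \<Longrightarrow> f differentiable (at x) \<Longrightarrow> g differentiable (at x) \<Longrightarrow>
    (\<lambda>y. h (f y) (g y)) differentiable (at x)"
  unfolding differentiable_def using bounded_bilinear.FDERIV by blast

lemma differentiable_bounded_linear:
  "bounded_linear h \<Longrightarrow> f differentiable (at x) \<Longrightarrow> (\<lambda>y. h (f y)) differentiable (at x)"
  unfolding differentiable_def using bounded_linear.has_derivative by blast

lemma Ck_on_add:
  assumes "open S"
  shows "Ck_on k S f \<Longrightarrow> Ck_on k S g \<Longrightarrow> Ck_on k S (\<lambda>x. f x + g x)"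
proof (induction k arbitrary: f g)
  case 0
  then show ?case by (auto intro: continuous_on_add)
next
  case (Suc k)
  have "Ck_on k S (\<lambda>x. frechet_derivative (\<lambda>x. f x + g x) (at x) v) \<longleftrightarrow>
      Ck_on k S (\<lambda>x. frechet_derivative f (at x) v + frechet_derivative g (at x) v)" for v
    by (rule Ck_on_cong[OF assms]) (use Suc.prems in \<open>simp add: frechet_derivative_add\<close>)
  then show ?case
    using Suc by simp
qed

lemma smooth_on_add:
  "open S \<Longrightarrow> smooth_on S f \<Longrightarrow> smooth_on S g \<Longrightarrow> smooth_on S (\<lambda>x. f x + g x)"
  by (simp add: smooth_on_def Ck_on_add)

lemma Ck_on_bounded_linear:
  assumes "open S" "bounded_linear h"
  shows "Ck_on k S f \<Longrightarrow> Ck_on k S (\<lambda>x. h (f x))"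
proof (induction k arbitrary: f)
  case 0
  then show ?case using bounded_linear.continuous_on[OF assms(2)] by simp
next
  case (Suc k)
  have "Ck_on k S (\<lambda>x. frechet_derivative (\<lambda>x. h (f x)) (at x) v) \<longleftrightarrow>
      Ck_on k S (\<lambda>x. h (frechet_derivative f (at x) v))" for v
    by (rule Ck_on_cong[OF assms(1)])
      (use Suc.prems in \<open>simp add: frechet_derivative_bounded_linear[OF assms(2)]\<close>)
  then show ?case
    using Suc by (auto intro: differentiable_bounded_linear[OF assms(2)])
qed

lemma smooth_on_bounded_linear:
  "open S \<Longrightarrow> bounded_linear h \<Longrightarrow> smooth_on S f \<Longrightarrow> smooth_on S (\<lambda>x. h (f x))"
  by (simp add: smooth_on_def Ck_on_bounded_linear)

lemma smooth_on_minus: "open S \<Longrightarrow> smooth_on S f \<Longrightarrow> smooth_on S (\<lambda>x. - f x)"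
  using smooth_on_bounded_linear[OF _ bounded_linear_minus[OF bounded_linear_ident]] by blast

lemma smooth_on_diff:
  "open S \<Longrightarrow> smooth_on S f \<Longrightarrow> smooth_on S g \<Longrightarrow> smooth_on S (\<lambda>x. f x - g x)"
  using smooth_on_add[OF _ _ smooth_on_minus, of S f g] by simp

lemma smooth_on_sum:
  "open S \<Longrightarrow> (\<And>i. i \<in> I \<Longrightarrow> smooth_on S (f i)) \<Longrightarrow> smooth_on S (\<lambda>x. \<Sum>i\<in>I. f i x)"
  by (induction I rule: infinite_finite_induct) (auto intro: smooth_on_const smooth_on_add)

lemma Ck_on_bounded_bilinear:
  assumes "open S" "bounded_bilinear h"
  shows "Ck_on k S f \<Longrightarrow> Ck_on k S g \<Longrightarrow> Ck_on k S (\<lambda>x. h (f x) (g x))"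
proof (induction k arbitrary: f g)
  case 0
  then show ?case using bounded_bilinear.continuous_on[OF assms(2)] by simp
next
  case (Suc k)
  have "Ck_on k S (\<lambda>x. frechet_derivative (\<lambda>x. h (f x) (g x)) (at x) v) \<longleftrightarrow>
      Ck_on k S (\<lambda>x. h (f x) (frechet_derivative g (at x) v) +
        h (frechet_derivative f (at x) v) (g x))" for v
    by (rule Ck_on_cong[OF assms(1)])
      (use Suc.prems in \<open>simp add: frechet_derivative_bounded_bilinear[OF assms(2)]\<close>)
  \<comment> \<open>Each Leibniz term pairs a derivative with the other function itself, so that
    function is also needed at level k.\<close>
  moreover have "Ck_on k S (\<lambda>x. h (f x) (frechet_derivative g (at x) v) +
        h (frechet_derivative f (at x) v) (g x))" for v
    using Suc.prems by (intro Ck_on_add[OF assms(1)] Suc.IH Ck_on_Suc_imp[of k S f]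
        Ck_on_Suc_imp[of k S g]) auto
  ultimately show ?case
    using Suc.prems by (auto intro: differentiable_bounded_bilinear[OF assms(2)])
qed

lemma smooth_on_bounded_bilinear:
  "open S \<Longrightarrow> bounded_bilinear h \<Longrightarrow> smooth_on S f \<Longrightarrow> smooth_on S g \<Longrightarrow>
    smooth_on S (\<lambda>x. h (f x) (g x))"
  by (simp add: smooth_on_def Ck_on_bounded_bilinear)

lemma smooth_on_linear:
  fixes h :: "'b::euclidean_space \<Rightarrow> 'c::real_normed_vector"
  shows "open S \<Longrightarrow> linear h \<Longrightarrow> smooth_on S f \<Longrightarrow> smooth_on S (\<lambda>x. h (f x))"
  by (rule smooth_on_bounded_linear) (simp_all add: linear_conv_bounded_linear)

text \<open>\<open>V\<close> is cut out by the functionals \<open>\<lambda>v. v \<bullet> w\<close>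
  with w orthogonal to \<open>V\<close>. Each is zero along f, hence zero on the derivative. This
  keeps derivatives of forms inside the graded pieces.\<close>

lemma frechet_derivative_in_subspace:
  fixes f :: "'a::euclidean_space \<Rightarrow> 'b::euclidean_space"
  assumes "subspace V" "open S" "x \<in> S" "f differentiable (at x)" "\<And>y. y \<in> S \<Longrightarrow> f y \<in> V"
  shows "frechet_derivative f (at x) v \<in> V"
proof -
  have "frechet_derivative f (at x) v \<bullet> w = 0" if w: "w \<in> V\<^sup>\<bottom>" for w
  proof -
    have "frechet_derivative (\<lambda>y. f y \<bullet> w) (at x) v = frechet_derivative f (at x) v \<bullet> w"
      by (rule frechet_derivative_bounded_linear[OF bounded_linear_inner_left assms(4)])
    moreover have "frechet_derivative (\<lambda>y. f y \<bullet> w) (at x) = frechet_derivative (\<lambda>y. 0::real) (at x)"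
      using w assms(5)
      by (intro frechet_derivative_cong_open[OF assms(2,3)])
        (auto simp: orthogonal_comp_def orthogonal_def)
    ultimately show ?thesis by simp
  qed
  then have "frechet_derivative f (at x) v \<in> V\<^sup>\<bottom>\<^sup>\<bottom>"
    by (auto simp: orthogonal_comp_def orthogonal_def inner_commute)
  then show ?thesis
    using orthogonal_comp_self[OF assms(1)] by simp
qed

text \<open>Schwarz's theorem, from the mean value theorem applied twice to the mixed second
  difference.\<close>

lemma mixed_difference_mean_value:
  fixes f :: "'a::real_normed_vector \<Rightarrow> real"
  assumes C2: "Ck_on 2 S f" and "0 < h"
    and sub: "\<And>s t. 0 \<le> s \<Longrightarrow> s \<le> h \<Longrightarrow> 0 \<le> t \<Longrightarrow> t \<le> h \<Longrightarrow> x + s *\<^sub>R v + t *\<^sub>R w \<in> S"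
  obtains s t where "0 < s" "s < h" "0 < t" "t < h"
    "f (x + h *\<^sub>R v + h *\<^sub>R w) - f (x + h *\<^sub>R v) - f (x + h *\<^sub>R w) + f x =
      h * h * frechet_derivative (\<lambda>y. frechet_derivative f (at y) v)
        (at (x + s *\<^sub>R v + t *\<^sub>R w)) w"
proof -
  define f1 where "f1 y = frechet_derivative f (at y) v" for y
  have d1: "(f has_derivative frechet_derivative f (at y)) (at y)" if "y \<in> S" for y
    using C2 that by (simp add: numeral_2_eq_2 frechet_derivative_works)
  have d2: "(f1 has_derivative frechet_derivative f1 (at y)) (at y)" if "y \<in> S" for y
    using C2 that unfolding f1_def by (simp add: numeral_2_eq_2 frechet_derivative_works)
  have D1: "DERIV (\<lambda>s. f (x + s *\<^sub>R v + t *\<^sub>R w)) s :> f1 (x + s *\<^sub>R v + t *\<^sub>R w)"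
    if "0 \<le> s" "s \<le> h" "0 \<le> t" "t \<le> h" for s t
  proof -
    have "((\<lambda>s. x + s *\<^sub>R v + t *\<^sub>R w) has_derivative (\<lambda>r. r *\<^sub>R v)) (at s)"
      by (auto intro!: derivative_eq_intros)
    from diff_chain_at[OF this d1[OF sub[OF that]]]
    have "((\<lambda>s. f (x + s *\<^sub>R v + t *\<^sub>R w)) has_derivative
        (\<lambda>r. frechet_derivative f (at (x + s *\<^sub>R v + t *\<^sub>R w)) (r *\<^sub>R v))) (at s)"
      by (simp add: o_def)
    moreover have "frechet_derivative f (at (x + s *\<^sub>R v + t *\<^sub>R w)) (r *\<^sub>R v) =
        f1 (x + s *\<^sub>R v + t *\<^sub>R w) * r" for r
      using has_derivative_linear[OF d1[OF sub[OF that]]] by (simp add: f1_def linear_cmul)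
    ultimately show ?thesis
      by (simp add: has_field_derivative_def)
  qed
  \<comment> \<open>The mean value theorem in s for the difference between the edges t = h and t =
    0; the zero multiples make all four corners instances of \<open>D1\<close>.\<close>
  have "\<exists>s>0. s < h \<and> (f (x + h *\<^sub>R v + h *\<^sub>R w) - f (x + h *\<^sub>R v + 0 *\<^sub>R w)) -
      (f (x + 0 *\<^sub>R v + h *\<^sub>R w) - f (x + 0 *\<^sub>R v + 0 *\<^sub>R w)) =
      (h - 0) * (f1 (x + s *\<^sub>R v + h *\<^sub>R w) - f1 (x + s *\<^sub>R v + 0 *\<^sub>R w))"
    using assms(2) by (intro MVT2 DERIV_diff D1) auto
  then obtain s where s: "0 < s" "s < h" and
    e1: "f (x + h *\<^sub>R v + h *\<^sub>R w) - f (x + h *\<^sub>R v) - f (x + h *\<^sub>R w) + f x =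
      h * (f1 (x + s *\<^sub>R v + h *\<^sub>R w) - f1 (x + s *\<^sub>R v))"
    by (auto simp: algebra_simps)
  have D2: "DERIV (\<lambda>t. f1 (x + s *\<^sub>R v + t *\<^sub>R w)) t :>
      frechet_derivative f1 (at (x + s *\<^sub>R v + t *\<^sub>R w)) w" if "0 \<le> t" "t \<le> h" for t
  proof -
    have m: "x + s *\<^sub>R v + t *\<^sub>R w \<in> S"
      using s that by (intro sub) auto
    have "((\<lambda>t. x + s *\<^sub>R v + t *\<^sub>R w) has_derivative (\<lambda>r. r *\<^sub>R w)) (at t)"
      by (auto intro!: derivative_eq_intros)
    from diff_chain_at[OF this d2[OF m]]
    have "((\<lambda>t. f1 (x + s *\<^sub>R v + t *\<^sub>R w)) has_derivative
        (\<lambda>r. frechet_derivative f1 (at (x + s *\<^sub>R v + t *\<^sub>R w)) (r *\<^sub>R w))) (at t)"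
      by (simp add: o_def)
    moreover have "frechet_derivative f1 (at (x + s *\<^sub>R v + t *\<^sub>R w)) (r *\<^sub>R w) =
        frechet_derivative f1 (at (x + s *\<^sub>R v + t *\<^sub>R w)) w * r" for r
      using has_derivative_linear[OF d2[OF m]] by (simp add: linear_cmul)
    ultimately show ?thesis
      by (simp add: has_field_derivative_def)
  qed
  have "\<exists>t>0. t < h \<and> f1 (x + s *\<^sub>R v + h *\<^sub>R w) - f1 (x + s *\<^sub>R v + 0 *\<^sub>R w) =
      (h - 0) * frechet_derivative f1 (at (x + s *\<^sub>R v + t *\<^sub>R w)) w"
    using assms(2) by (intro MVT2 D2) auto
  then obtain t where t: "0 < t" "t < h" and
    e2: "f1 (x + s *\<^sub>R v + h *\<^sub>R w) - f1 (x + s *\<^sub>R v) =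
      h * frechet_derivative f1 (at (x + s *\<^sub>R v + t *\<^sub>R w)) w"
    by auto
  show ?thesis
    using that[OF s t] e1 e2 unfolding f1_def[symmetric] by simp
qed

text \<open>Both iterated derivatives attain the value of the same mixed difference divided by h^2
  somewhere in one small parallelogram at x. Continuity would keep them apart if they differed at
  x.\<close>

lemma frechet_derivative_commute_real:
  fixes f :: "'a::real_normed_vector \<Rightarrow> real"
  assumes "open S" "x \<in> S" "Ck_on 2 S f"
  shows "frechet_derivative (\<lambda>y. frechet_derivative f (at y) v) (at x) w =
    frechet_derivative (\<lambda>y. frechet_derivative f (at y) w) (at x) v"
proof (rule ccontr)
  define F where "F y = frechet_derivative (\<lambda>y. frechet_derivative f (at y) v) (at y) w" for y
  define G where "G y = frechet_derivative (\<lambda>y. frechet_derivative f (at y) w) (at y) v" for y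
  assume "\<not> ?thesis"
  then have ne: "F x \<noteq> G x" by (simp add: F_def G_def)
  \<comment> \<open>Half the gap, so that the open e-balls around \<open>F x\<close> and
    \<open>G x\<close> are disjoint.\<close>
  define e where "e = \<bar>F x - G x\<bar> / 2"
  have e: "e > 0" using ne by (simp add: e_def)
  have "continuous_on S F" "continuous_on S G"
    using assms(3) unfolding F_def G_def by (simp_all add: numeral_2_eq_2)
  then obtain d1 d2 where d: "d1 > 0" "\<And>y. y \<in> S \<Longrightarrow> dist y x < d1 \<Longrightarrow> dist (F y) (F x) < e"
    "d2 > 0" "\<And>y. y \<in> S \<Longrightarrow> dist y x < d2 \<Longrightarrow> dist (G y) (G x) < e"
    using assms(2) e unfolding continuous_on_iff by metis
  obtain d3 where d3: "d3 > 0" "ball x d3 \<subseteq> S"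
    using assms(1,2) open_contains_ball by blast
  define d' where "d' = min d1 (min d2 d3)"
  \<comment> \<open>The parallelogram with sides h v and h w then stays within d'/2 of x; the
    summand 1 keeps the divisor positive when v and w are both 0.\<close>
  define h where "h = d' / (norm v + norm w + 1) / 2"
  have d': "d' > 0" using d d3 by (simp add: d'_def)
  have pos: "norm v + norm w + 1 > 0"
    by (smt (verit) norm_ge_zero)
  have h: "h > 0" using d' pos by (simp add: h_def)
  have near: "dist (x + s *\<^sub>R v + t *\<^sub>R w) x < d'" if "0 \<le> s" "s \<le> h" "0 \<le> t" "t \<le> h" for s t
  proof -
    have "dist (x + s *\<^sub>R v + t *\<^sub>R w) x = norm (s *\<^sub>R v + t *\<^sub>R w)"
      by (simp add: dist_norm algebra_simps)
    also have "\<dots> \<le> s * norm v + t * norm w"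
      using that by (metis abs_of_nonneg norm_scaleR norm_triangle_ineq)
    also have "\<dots> \<le> h * norm v + h * norm w"
      using that by (intro add_mono mult_right_mono) auto
    also have "\<dots> \<le> h * (norm v + norm w + 1)"
      using h by (simp add: algebra_simps)
    also have "\<dots> = d' / 2"
      using pos unfolding h_def by (metis nonzero_eq_divide_eq times_divide_eq_left less_irrefl)
    also have "\<dots> < d'" using d' by simp
    finally show ?thesis .
  qed
  have inS: "y \<in> S" if "dist y x < d'" for y
    using that d3(2) by (auto simp: d'_def dist_commute)
  have sub: "x + s *\<^sub>R v + t *\<^sub>R w \<in> S" if "0 \<le> s" "s \<le> h" "0 \<le> t" "t \<le> h" for s t
    using inS near that by blast
  have sub': "x + s *\<^sub>R w + t *\<^sub>R v \<in> S" if "0 \<le> s" "s \<le> h" "0 \<le> t" "t \<le> h" for s t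
    using sub[of t s] that by (simp add: algebra_simps)
  obtain s t where st: "0 < s" "s < h" "0 < t" "t < h"
    "f (x + h *\<^sub>R v + h *\<^sub>R w) - f (x + h *\<^sub>R v) - f (x + h *\<^sub>R w) + f x =
      h * h * F (x + s *\<^sub>R v + t *\<^sub>R w)"
    using mixed_difference_mean_value[OF assms(3) h sub] unfolding F_def by blast
  obtain s' t' where st': "0 < s'" "s' < h" "0 < t'" "t' < h"
    "f (x + h *\<^sub>R w + h *\<^sub>R v) - f (x + h *\<^sub>R w) - f (x + h *\<^sub>R v) + f x =
      h * h * G (x + s' *\<^sub>R w + t' *\<^sub>R v)"
    using mixed_difference_mean_value[OF assms(3) h sub'] unfolding G_def by blast
  define y where "y = x + s *\<^sub>R v + t *\<^sub>R w"
  \<comment> \<open>The second mean value point, with its edges put in the order v, w expected by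
    \<open>near\<close>.\<close>
  define z where "z = x + t' *\<^sub>R v + s' *\<^sub>R w"
  have z: "z = x + s' *\<^sub>R w + t' *\<^sub>R v" by (simp add: z_def)
  have "h * h * F y = h * h * G z"
    using st(5) st'(5) unfolding y_def z by (simp add: algebra_simps)
  then have "F y = G z" using h by simp
  moreover have "dist y x < d'" "dist z x < d'"
    unfolding y_def z_def using st st' by (auto intro!: near)
  then have "dist (F y) (F x) < e" "dist (G z) (G x) < e"
    using d(2,4) inS by (auto simp: d'_def)
  ultimately show False
    by (auto simp: e_def dist_real_def abs_if split: if_splits)
qed

text \<open>Pairing with a basis vector is bounded linear and passes through both derivatives, which
  reduces the claim to real functions.\<close>

lemma frechet_derivative_commute:
  fixes f :: "'a::real_normed_vector \<Rightarrow> 'b::euclidean_space"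
  assumes "open S" "x \<in> S" "smooth_on S f"
  shows "frechet_derivative (\<lambda>y. frechet_derivative f (at y) v) (at x) w =
    frechet_derivative (\<lambda>y. frechet_derivative f (at y) w) (at x) v"
proof (rule euclidean_eqI)
  fix b :: 'b
  define g where "g = (\<lambda>y. f y \<bullet> b)"
  have g: "Ck_on 2 S g"
    using smooth_on_bounded_linear[OF assms(1) bounded_linear_inner_left assms(3)]
    by (simp add: smooth_on_def g_def)
  have *: "frechet_derivative (\<lambda>y. frechet_derivative f (at y) v) (at x) w \<bullet> b =
      frechet_derivative (\<lambda>y. frechet_derivative g (at y) v) (at x) w" for v w
  proof -
    have "frechet_derivative (\<lambda>y. frechet_derivative g (at y) v) (at x) =
        frechet_derivative (\<lambda>y. frechet_derivative f (at y) v \<bullet> b) (at x)"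
      unfolding g_def
      by (intro frechet_derivative_cong_open[OF assms(1,2)]
          frechet_derivative_bounded_linear[OF bounded_linear_inner_left]
          smooth_on_imp_differentiable[OF assms(3)])
    then show ?thesis
      using frechet_derivative_bounded_linear[OF bounded_linear_inner_left
          smooth_on_imp_differentiable[OF smooth_on_frechet_derivative[OF assms(3)] assms(2)]]
      by simp
  qed
  show "frechet_derivative (\<lambda>y. frechet_derivative f (at y) v) (at x) w \<bullet> b =
      frechet_derivative (\<lambda>y. frechet_derivative f (at y) w) (at x) v \<bullet> b"
    unfolding * by (rule frechet_derivative_commute_real[OF assms(1,2) g])
qed

section \<open>Charts, tangent vectors and forms in coordinates\<close>

text \<open>The component of \<alpha> along a constant coordinate vector. The point is the last
  argument, so that fixing \<xi> leaves a function on the chart image that can be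
  differentiated.\<close>

definition local_form :: "('m, 'e::euclidean_space) chart set \<Rightarrow> ('m, 'e) chart \<Rightarrow>
    ('m, 'e, 'v) form1 \<Rightarrow> 'e \<Rightarrow> 'e \<Rightarrow> 'v" where
  "local_form A c \<alpha> \<xi> y = \<alpha> (chart_inv c y) (coord_vec A c (chart_inv c y) \<xi>)"

text \<open>The formula of \<open>ext_deriv\<close> with the chart as a parameter, so that it can be
  followed over an open set in one chart.\<close>

definition local_ext_deriv :: "('m, 'e::euclidean_space) chart set \<Rightarrow> ('m, 'e) chart \<Rightarrow>
    ('m, 'e, 'v::real_normed_vector) form1 \<Rightarrow> 'e \<Rightarrow> 'e \<Rightarrow> 'e \<Rightarrow> 'v" where
  "local_ext_deriv A c \<alpha> y \<xi> \<eta> = frechet_derivative (local_form A c \<alpha> \<eta>) (at y) \<xi>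
     - frechet_derivative (local_form A c \<alpha> \<xi>) (at y) \<eta>"

definition differential :: "('m, 'e::euclidean_space) chart set \<Rightarrow> ('m \<Rightarrow> 'v::real_normed_vector) \<Rightarrow>
    ('m, 'e, 'v) form1" where
  "differential A f x X = (let c = chart_at A x in
     frechet_derivative (f \<circ> chart_inv c) (at (snd c x)) (X c))"

lemma ext_deriv_eq_local:
  "ext_deriv A \<alpha> x X Y =
    local_ext_deriv A (chart_at A x) \<alpha> (snd (chart_at A x) x) (X (chart_at A x)) (Y (chart_at A x))"
  by (simp add: ext_deriv_def local_ext_deriv_def Let_def local_form_def[abs_def])

lemma smooth_form1_values: "smooth_form1 A U S \<alpha> \<Longrightarrow> x \<in> U \<Longrightarrow> X \<in> tangent_space A x \<Longrightarrow> \<alpha> x X \<in> S"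
  by (simp add: smooth_form1_def)

lemma smooth_form1_combination:
  "smooth_form1 A U S \<alpha> \<Longrightarrow> x \<in> U \<Longrightarrow> X \<in> tangent_space A x \<Longrightarrow> Y \<in> tangent_space A x \<Longrightarrow>
    \<alpha> x (\<lambda>c. a *\<^sub>R X c + b *\<^sub>R Y c) = a *\<^sub>R \<alpha> x X + b *\<^sub>R \<alpha> x Y"
  by (simp add: smooth_form1_def)

lemma smooth_form1_smooth_on:
  "smooth_form1 A U S \<alpha> \<Longrightarrow> c \<in> A \<Longrightarrow> smooth_on (snd c ` (fst c \<inter> U)) (local_form A c \<alpha> \<xi>)"
  by (simp add: smooth_form1_def local_form_def[abs_def])

locale smooth_atlas =
  fixes A :: "('m::{t2_space,second_countable_topology}, 'e::euclidean_space) chart set"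
  assumes smooth_manifold: "smooth_manifold A"
begin

lemma open_chart_domain: "c \<in> A \<Longrightarrow> open (fst c)"
  using smooth_manifold by (auto simp: smooth_manifold_def)

lemma chart_homeomorphism: "c \<in> A \<Longrightarrow> homeomorphism (fst c) (snd c ` fst c) (snd c) (chart_inv c)"
  using smooth_manifold by (auto simp: smooth_manifold_def)

lemma chart_inv_chart: "c \<in> A \<Longrightarrow> x \<in> fst c \<Longrightarrow> chart_inv c (snd c x) = x"
  using chart_homeomorphism by (auto simp: homeomorphism_def)

lemma open_chart_image:
  assumes "c \<in> A" "open V"
  shows "open (snd c ` (fst c \<inter> V))"
proof -
  have "openin (top_of_set (snd c ` fst c)) (snd c ` (fst c \<inter> V))"
    using homeomorphism_imp_open_map[OF chart_homeomorphism[OF assms(1)]] assms(2) by blast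
  moreover have "open (snd c ` fst c)"
    using smooth_manifold assms(1) by (auto simp: smooth_manifold_def)
  ultimately show ?thesis
    using openin_open_trans by blast
qed

lemma chart_at: "chart_at A x \<in> A" "x \<in> fst (chart_at A x)"
proof -
  have "(\<Union>c\<in>A. fst c) = UNIV"
    using smooth_manifold unfolding smooth_manifold_def by blast
  then have "\<exists>c. c \<in> A \<and> x \<in> fst c"
    by blast
  then have "chart_at A x \<in> A \<and> x \<in> fst (chart_at A x)"
    unfolding chart_at_def by (rule someI_ex)
  then show "chart_at A x \<in> A" "x \<in> fst (chart_at A x)" by auto
qed

lemma smooth_on_transition:
  "c \<in> A \<Longrightarrow> d \<in> A \<Longrightarrow> smooth_on (snd c ` (fst c \<inter> fst d)) (snd d \<circ> chart_inv c)"
  using smooth_manifold by (auto simp: smooth_manifold_def)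

lemma differentiable_transition:
  assumes "c \<in> A" "d \<in> A" "x \<in> fst c" "x \<in> fst d"
  shows "(snd d \<circ> chart_inv c) differentiable (at (snd c x))"
  using smooth_on_imp_differentiable[OF smooth_on_transition[OF assms(1,2)]] assms(3,4) by blast

text \<open>Chain rule: f read in c is f read in d after the transition map. This factorisation
  holds only over the overlap of the domains, hence the passage through an open set.\<close>

lemma has_derivative_change_chart:
  fixes f :: "'m \<Rightarrow> 'v::real_normed_vector"
  assumes "c \<in> A" "d \<in> A" "x \<in> fst c" "x \<in> fst d"
    and "(f \<circ> chart_inv d has_derivative D) (at (snd d x))"
  shows "(f \<circ> chart_inv c has_derivative
    D \<circ> frechet_derivative (snd d \<circ> chart_inv c) (at (snd c x))) (at (snd c x))"
proof -
  have "(snd d \<circ> chart_inv c has_derivative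
      frechet_derivative (snd d \<circ> chart_inv c) (at (snd c x))) (at (snd c x))"
    using differentiable_transition[OF assms(1-4)] by (simp add: frechet_derivative_works)
  moreover have "(f \<circ> chart_inv d has_derivative D) (at ((snd d \<circ> chart_inv c) (snd c x)))"
    using assms by (simp add: chart_inv_chart)
  ultimately have "((f \<circ> chart_inv d) \<circ> (snd d \<circ> chart_inv c) has_derivative
      D \<circ> frechet_derivative (snd d \<circ> chart_inv c) (at (snd c x))) (at (snd c x))"
    by (rule diff_chain_at)
  then show ?thesis
  proof (rule has_derivative_transform_within_open)
    show "open (snd c ` (fst c \<inter> fst d))"
      using assms open_chart_image open_chart_domain by blast
  qed (use assms in \<open>auto simp: chart_inv_chart\<close>)
qed

lemma frechet_derivative_change_chart:
  fixes f :: "'m \<Rightarrow> 'v::real_normed_vector"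
  assumes "c \<in> A" "d \<in> A" "x \<in> fst c" "x \<in> fst d"
    and "(f \<circ> chart_inv d) differentiable (at (snd d x))"
  shows "frechet_derivative (f \<circ> chart_inv c) (at (snd c x)) \<xi> =
    frechet_derivative (f \<circ> chart_inv d) (at (snd d x))
      (frechet_derivative (snd d \<circ> chart_inv c) (at (snd c x)) \<xi>)"
  using frechet_derivative_eqI[OF has_derivative_change_chart[OF assms(1-4)
      assms(5)[unfolded frechet_derivative_works]]]
  by simp

lemma frechet_derivative_transition_self:
  assumes "c \<in> A" "x \<in> fst c"
  shows "frechet_derivative (snd c \<circ> chart_inv c) (at (snd c x)) \<xi> = \<xi>"
proof -
  have "frechet_derivative (snd c \<circ> chart_inv c) (at (snd c x)) =
      frechet_derivative (\<lambda>y. y) (at (snd c x))"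
    using open_chart_image[OF assms(1), of UNIV] assms
    by (intro frechet_derivative_cong_open[of "snd c ` fst c"]) (auto simp: chart_inv_chart)
  then show ?thesis by simp
qed

lemma coord_vec_self: "c \<in> A \<Longrightarrow> x \<in> fst c \<Longrightarrow> coord_vec A c x \<xi> c = \<xi>"
  by (simp add: coord_vec_def frechet_derivative_transition_self)

text \<open>The compatibility between two charts d and e is the chain rule for the passage from c to
  e through d.\<close>

lemma coord_vec_tangent:
  assumes "c \<in> A" "x \<in> fst c"
  shows "coord_vec A c x \<xi> \<in> tangent_space A x"
  unfolding tangent_space_def
proof (intro CollectI conjI ballI impI allI)
  fix d e assume "d \<in> A" "e \<in> A" "x \<in> fst d" "x \<in> fst e"
  then show "coord_vec A c x \<xi> e =
      frechet_derivative (snd e \<circ> chart_inv d) (at (snd d x)) (coord_vec A c x \<xi> d)"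
    using frechet_derivative_change_chart[OF assms(1) _ assms(2), of d "snd e"]
      differentiable_transition[of d e x]
    by (simp add: coord_vec_def)
qed (auto simp: coord_vec_def)

text \<open>One component determines the whole family: transition derivatives give the components in
  the charts around x, and everywhere else both families have the default value 0.\<close>

lemma coord_vec_tangent_eq:
  assumes "c \<in> A" "x \<in> fst c" "X \<in> tangent_space A x"
  shows "coord_vec A c x (X c) = X"
proof
  fix d
  show "coord_vec A c x (X c) d = X d"
  proof (cases "d \<in> A \<and> x \<in> fst d")
    case True
    then have "X d = frechet_derivative (snd d \<circ> chart_inv c) (at (snd c x)) (X c)"
      using assms unfolding tangent_space_def by blast
    then show ?thesis using True by (metis coord_vec_def)
  next
    case False
    then have "X d = 0"
      using assms unfolding tangent_space_def by blast
    then show ?thesis using False by (metis coord_vec_def)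
  qed
qed

lemma tangent_change_chart:
  assumes "c \<in> A" "d \<in> A" "x \<in> fst c" "x \<in> fst d" "X \<in> tangent_space A x"
  shows "X d = frechet_derivative (snd d \<circ> chart_inv c) (at (snd c x)) (X c)"
  using assms unfolding tangent_space_def by blast

lemma tangent_eqI:
  assumes "c \<in> A" "x \<in> fst c" "X \<in> tangent_space A x" "Y \<in> tangent_space A x" "X c = Y c"
  shows "X = Y"
  by (metis assms coord_vec_tangent_eq)

lemma tangent_combination:
  assumes "X \<in> tangent_space A x" "Y \<in> tangent_space A x"
  shows "(\<lambda>c. a *\<^sub>R X c + b *\<^sub>R Y c) \<in> tangent_space A x"
proof -
  have "frechet_derivative (snd d \<circ> chart_inv c) (at (snd c x)) (a *\<^sub>R X c + b *\<^sub>R Y c) =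
      a *\<^sub>R X d + b *\<^sub>R Y d" if "c \<in> A" "d \<in> A" "x \<in> fst c" "x \<in> fst d" for c d
    using linear_frechet_derivative[OF differentiable_transition[OF that]]
      tangent_change_chart[OF that] assms
    by (simp add: linear_add linear_cmul)
  moreover have "X c = 0" "Y c = 0" if "\<not> (c \<in> A \<and> x \<in> fst c)" for c
    using that assms unfolding tangent_space_def by blast+
  ultimately show ?thesis
    unfolding tangent_space_def by (intro CollectI conjI ballI impI allI) auto
qed

lemma coord_vec_combination:
  assumes "c \<in> A" "x \<in> fst c"
  shows "coord_vec A c x (a *\<^sub>R \<xi> + b *\<^sub>R \<eta>) =
    (\<lambda>d. a *\<^sub>R coord_vec A c x \<xi> d + b *\<^sub>R coord_vec A c x \<eta> d)"
  by (rule tangent_eqI[OF assms coord_vec_tangent[OF assms]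
        tangent_combination[OF coord_vec_tangent[OF assms] coord_vec_tangent[OF assms]]])
    (simp add: coord_vec_self[OF assms])

lemma smooth_map_on_euclI:
  fixes f :: "'m \<Rightarrow> 'f::euclidean_space"
  assumes "open U" "\<And>c. c \<in> A \<Longrightarrow> smooth_on (snd c ` (fst c \<inter> U)) (f \<circ> chart_inv c)"
  shows "smooth_map_on U A eucl_atlas f"
  using assms by (auto simp: smooth_map_on_def eucl_atlas_def o_def)

lemma smooth_map_on_euclD:
  fixes f :: "'m \<Rightarrow> 'f::euclidean_space"
  assumes "smooth_map_on U A eucl_atlas f" "c \<in> A"
  shows "smooth_on (snd c ` (fst c \<inter> U)) (f \<circ> chart_inv c)"
  using assms by (auto simp: smooth_map_on_def eucl_atlas_def o_def)

lemma differential_chart: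
  fixes f :: "'m \<Rightarrow> 'f::euclidean_space"
  assumes "smooth_map_on U A eucl_atlas f" "c \<in> A" "x \<in> fst c" "x \<in> U" "X \<in> tangent_space A x"
  shows "differential A f x X = frechet_derivative (f \<circ> chart_inv c) (at (snd c x)) (X c)"
proof -
  have "(f \<circ> chart_inv c) differentiable (at (snd c x))"
    using smooth_on_imp_differentiable[OF smooth_map_on_euclD[OF assms(1,2)]] assms(3,4) by auto
  then show ?thesis
    using frechet_derivative_change_chart[OF chart_at(1) assms(2) chart_at(2) assms(3), of f "X (chart_at A x)"]
      tangent_change_chart[OF chart_at(1) assms(2) chart_at(2) assms(3,5)]
    by (simp add: differential_def Let_def)
qed

text \<open>The chart inside \<open>differential\<close> varies with the point without any
  regularity; smoothness of the components becomes visible only after the change to the fixed chart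
  c.\<close>

lemma local_form_differential:
  fixes f :: "'m \<Rightarrow> 'f::euclidean_space"
  assumes "smooth_map_on U A eucl_atlas f" "c \<in> A" "y \<in> snd c ` (fst c \<inter> U)"
  shows "local_form A c (differential A f) \<xi> y = frechet_derivative (f \<circ> chart_inv c) (at y) \<xi>"
proof -
  obtain x where x: "x \<in> fst c" "x \<in> U" "y = snd c x"
    using assms(3) by auto
  have "differential A f x (coord_vec A c x \<xi>) =
      frechet_derivative (f \<circ> chart_inv c) (at (snd c x)) (coord_vec A c x \<xi> c)"
    using x assms by (intro differential_chart coord_vec_tangent)
  then show ?thesis
    using x assms by (simp add: local_form_def chart_inv_chart coord_vec_self)
qed

lemma smooth_form1_differential:
  fixes f :: "'m \<Rightarrow> 'f::euclidean_space"
  assumes f: "smooth_map_on U A eucl_atlas f" and U: "open U"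
    and V: "subspace V" "\<And>x. x \<in> U \<Longrightarrow> f x \<in> V"
  shows "smooth_form1 A U V (differential A f)"
  unfolding smooth_form1_def
proof (intro conjI ballI allI)
  fix x X Y and a b :: real
  assume x: "x \<in> U" and X: "X \<in> tangent_space A x"
  define c where "c = chart_at A x"
  have c: "c \<in> A" "x \<in> fst c" by (simp_all add: c_def chart_at)
  have diff: "(f \<circ> chart_inv c) differentiable (at (snd c x))"
    using smooth_on_imp_differentiable[OF smooth_map_on_euclD[OF f c(1)]] c x by auto
  have "frechet_derivative (f \<circ> chart_inv c) (at (snd c x)) (X c) \<in> V"
    using V c x
    by (intro frechet_derivative_in_subspace[OF V(1) open_chart_image[OF c(1) U] _ diff])
      (auto simp: chart_inv_chart)
  then show "differential A f x X \<in> V"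
    by (simp add: differential_def Let_def c_def)
  show "differential A f x (\<lambda>c. a *\<^sub>R X c + b *\<^sub>R Y c) =
      a *\<^sub>R differential A f x X + b *\<^sub>R differential A f x Y"
    using linear_frechet_derivative[OF diff]
    by (simp add: differential_def Let_def c_def linear_add linear_cmul)
next
  fix c \<xi> assume c: "c \<in> A"
  have "smooth_on (snd c ` (fst c \<inter> U)) (local_form A c (differential A f) \<xi>)"
    using smooth_on_frechet_derivative[OF smooth_map_on_euclD[OF f c]]
      smooth_on_cong[OF open_chart_image[OF c U], of "local_form A c (differential A f) \<xi>"]
      local_form_differential[OF f c]
    by simp
  then show "smooth_on (snd c ` (fst c \<inter> U))
      (\<lambda>y. differential A f (chart_inv c y) (coord_vec A c (chart_inv c y) \<xi>))"
    by (simp add: local_form_def[abs_def])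
qed

section \<open>Components of a form and the exterior derivative under change of chart\<close>

lemma local_form_combination:
  assumes "smooth_form1 A U S \<alpha>" "c \<in> A" "y \<in> snd c ` (fst c \<inter> U)"
  shows "local_form A c \<alpha> (a *\<^sub>R \<xi> + b *\<^sub>R \<eta>) y = a *\<^sub>R local_form A c \<alpha> \<xi> y + b *\<^sub>R local_form A c \<alpha> \<eta> y"
  using assms
  by (auto simp: local_form_def chart_inv_chart coord_vec_combination coord_vec_tangent
      smooth_form1_combination)

lemma linear_local_form:
  assumes "smooth_form1 A U S \<alpha>" "c \<in> A" "y \<in> snd c ` (fst c \<inter> U)"
  shows "linear (\<lambda>\<xi>. local_form A c \<alpha> \<xi> y)"
  using local_form_combination[OF assms, of 1 _ 1] local_form_combination[OF assms, of _ _ 0]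
  by (intro linearI) auto

text \<open>A change of chart inserts a vector that moves with the point. Expansion in the standard
  basis leaves finitely many component functions with scalar coefficients, to which the product rule
  applies.\<close>

lemma local_form_sum_Basis:
  assumes "smooth_form1 A U S \<alpha>" "c \<in> A" "y \<in> snd c ` (fst c \<inter> U)"
  shows "local_form A c \<alpha> \<xi> y = (\<Sum>b\<in>Basis. (\<xi> \<bullet> b) *\<^sub>R local_form A c \<alpha> b y)"
proof -
  have "local_form A c \<alpha> \<xi> y = local_form A c \<alpha> (\<Sum>b\<in>Basis. (\<xi> \<bullet> b) *\<^sub>R b) y"
    by (simp add: euclidean_representation)
  also have "\<dots> = (\<Sum>b\<in>Basis. (\<xi> \<bullet> b) *\<^sub>R local_form A c \<alpha> b y)"
    by (simp add: linear_sum[OF linear_local_form[OF assms]] linear_cmul[OF linear_local_form[OF assms]])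
  finally show ?thesis .
qed

lemma local_form_differentiable:
  assumes "smooth_form1 A U S \<alpha>" "c \<in> A" "y \<in> snd c ` (fst c \<inter> U)"
  shows "local_form A c \<alpha> \<xi> differentiable (at y)"
  using smooth_on_imp_differentiable[OF smooth_form1_smooth_on[OF assms(1,2)] assms(3)] .

text \<open>This concerns the vector inserted into the form, not the direction of differentiation:
  the linear relation between components holds on an open set and can be differentiated
  there.\<close>

lemma linear_frechet_derivative_local_form:
  assumes "open U" "smooth_form1 A U S \<alpha>" "c \<in> A" "y \<in> snd c ` (fst c \<inter> U)"
  shows "linear (\<lambda>\<xi>. frechet_derivative (local_form A c \<alpha> \<xi>) (at y) \<eta>)"
proof -
  have "frechet_derivative (local_form A c \<alpha> (a *\<^sub>R \<xi> + b *\<^sub>R \<zeta>)) (at y) \<eta> =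
      a *\<^sub>R frechet_derivative (local_form A c \<alpha> \<xi>) (at y) \<eta> +
      b *\<^sub>R frechet_derivative (local_form A c \<alpha> \<zeta>) (at y) \<eta>" for a b \<xi> \<zeta>
  proof -
    have "frechet_derivative (local_form A c \<alpha> (a *\<^sub>R \<xi> + b *\<^sub>R \<zeta>)) (at y) =
        frechet_derivative (\<lambda>y. a *\<^sub>R local_form A c \<alpha> \<xi> y + b *\<^sub>R local_form A c \<alpha> \<zeta> y) (at y)"
      using assms
      by (intro frechet_derivative_cong_open[OF open_chart_image assms(4)] local_form_combination)
    then show ?thesis
      using local_form_differentiable[OF assms(2-4)]
      by (simp add: frechet_derivative_add differentiable_bounded_linear[OF bounded_linear_scaleR_right]
          frechet_derivative_bounded_linear[OF bounded_linear_scaleR_right])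
  qed
  from this[of 1 _ 1] this[of _ _ 0] show ?thesis
    by (intro linearI) auto
qed

lemma coord_vec_change_chart:
  assumes "c \<in> A" "d \<in> A" "x \<in> fst c" "x \<in> fst d"
  shows "coord_vec A c x \<xi> =
    coord_vec A d x (frechet_derivative (snd d \<circ> chart_inv c) (at (snd c x)) \<xi>)"
  by (rule tangent_eqI[OF assms(2,4) coord_vec_tangent[OF assms(1,3)]
        coord_vec_tangent[OF assms(2,4)]])
    (use assms in \<open>simp add: coord_vec_self[OF assms(2,4)], simp add: coord_vec_def\<close>)

text \<open>The second derivatives of the transition map enter symmetrically, and cancel.\<close>

lemma local_ext_deriv_change_chart:
  fixes \<alpha> :: "('m, 'e, 'v::euclidean_space) form1"
  assumes \<alpha>: "smooth_form1 A U S \<alpha>" and U: "open U"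
    and c: "c \<in> A" "x \<in> fst c" and d: "d \<in> A" "x \<in> fst d" and x: "x \<in> U"
  defines "T \<equiv> snd d \<circ> chart_inv c"
  shows "local_ext_deriv A c \<alpha> (snd c x) \<xi> \<eta> =
    local_ext_deriv A d \<alpha> (snd d x) (frechet_derivative T (at (snd c x)) \<xi>)
      (frechet_derivative T (at (snd c x)) \<eta>)"
proof -
  let ?W = "snd c ` (fst c \<inter> (fst d \<inter> U))"
  let ?y = "snd c x"
  define T' where "T' = frechet_derivative T (at ?y)"
  define T2 where "T2 \<xi> \<eta> = frechet_derivative (\<lambda>y. frechet_derivative T (at y) \<xi>) (at ?y) \<eta>" for \<xi> \<eta>
  have W: "open ?W" "?y \<in> ?W"
    using open_chart_image[OF c(1) open_Int[OF open_chart_domain[OF d(1)] U]] c d x by auto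
  have T: "smooth_on ?W T"
    using smooth_on_transition[OF c(1) d(1)] unfolding T_def by (rule smooth_on_subset) auto
  have Ty: "T ?y = snd d x"
    using c by (simp add: T_def chart_inv_chart)
  \<comment> \<open>The vector inserted in chart d is the moving vector
    \<open>frechet_derivative T (at y) \<xi>\<close>; its basis coefficients become scalar functions
    of y.\<close>
  have eq: "local_form A c \<alpha> \<xi> y =
      (\<Sum>b\<in>Basis. (frechet_derivative T (at y) \<xi> \<bullet> b) *\<^sub>R local_form A d \<alpha> b (T y))"
    if y: "y \<in> ?W" for y \<xi>
  proof -
    obtain z where z: "z \<in> fst c" "z \<in> fst d" "z \<in> U" "y = snd c z" using y by auto
    have "local_form A c \<alpha> \<xi> y = local_form A d \<alpha> (frechet_derivative T (at y) \<xi>) (T y)"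
      using z c d coord_vec_change_chart[OF c(1) d(1) z(1,2)]
      by (simp add: local_form_def chart_inv_chart T_def)
    also have "\<dots> = (\<Sum>b\<in>Basis. (frechet_derivative T (at y) \<xi> \<bullet> b) *\<^sub>R local_form A d \<alpha> b (T y))"
      using z c by (intro local_form_sum_Basis[OF \<alpha> d(1)]) (simp add: T_def chart_inv_chart)
    finally show ?thesis .
  qed
  have sym: "T2 \<xi> \<eta> = T2 \<eta> \<xi>" for \<xi> \<eta>
    unfolding T2_def by (rule frechet_derivative_commute[OF W T])
  \<comment> \<open>Product rule on \<open>eq\<close>: the first summand differentiates the
    components of \<alpha> and is recombined by linearity, the second differentiates the
    coefficients.\<close>
  have D: "frechet_derivative (local_form A c \<alpha> \<xi>) (at ?y) \<eta> =
      frechet_derivative (local_form A d \<alpha> (T' \<xi>)) (at (snd d x)) (T' \<eta>) +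
      (\<Sum>b\<in>Basis. (T2 \<xi> \<eta> \<bullet> b) *\<^sub>R local_form A d \<alpha> b (snd d x))" for \<xi> \<eta>
  proof -
    have dx: "snd d x \<in> snd d ` (fst d \<inter> U)" using d x by auto
    have "(T has_derivative T') (at ?y)"
      using smooth_on_imp_differentiable[OF T W(2)] by (simp add: T'_def frechet_derivative_works)
    moreover have "(local_form A d \<alpha> b has_derivative
        frechet_derivative (local_form A d \<alpha> b) (at (snd d x))) (at (T ?y))" for b
      using local_form_differentiable[OF \<alpha> d(1) dx] by (simp add: Ty frechet_derivative_works)
    ultimately have 1: "((\<lambda>y. local_form A d \<alpha> b (T y)) has_derivative
        (\<lambda>h. frechet_derivative (local_form A d \<alpha> b) (at (snd d x)) (T' h))) (at ?y)" for b
      using diff_chain_at by (fastforce simp: o_def)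
    have "((\<lambda>y. frechet_derivative T (at y) \<xi>) has_derivative T2 \<xi>) (at ?y)"
      using smooth_on_imp_differentiable[OF smooth_on_frechet_derivative[OF T] W(2)]
      by (simp add: T2_def[abs_def] frechet_derivative_works)
    then have 2: "((\<lambda>y. frechet_derivative T (at y) \<xi> \<bullet> b) has_derivative (\<lambda>h. T2 \<xi> h \<bullet> b)) (at ?y)" for b
      by (rule has_derivative_inner_left)
    have 3: "((\<lambda>y. \<Sum>b\<in>Basis. (frechet_derivative T (at y) \<xi> \<bullet> b) *\<^sub>R local_form A d \<alpha> b (T y))
        has_derivative (\<lambda>h. \<Sum>b\<in>Basis.
          (T' \<xi> \<bullet> b) *\<^sub>R frechet_derivative (local_form A d \<alpha> b) (at (snd d x)) (T' h) +
          (T2 \<xi> h \<bullet> b) *\<^sub>R local_form A d \<alpha> b (snd d x))) (at ?y)"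
      using has_derivative_scaleR[OF 2 1] by (intro has_derivative_sum) (simp add: T'_def Ty)
    have "frechet_derivative (local_form A c \<alpha> \<xi>) (at ?y) \<eta> = (\<Sum>b\<in>Basis.
          (T' \<xi> \<bullet> b) *\<^sub>R frechet_derivative (local_form A d \<alpha> b) (at (snd d x)) (T' \<eta>) +
          (T2 \<xi> \<eta> \<bullet> b) *\<^sub>R local_form A d \<alpha> b (snd d x))"
      using frechet_derivative_cong_open[OF W eq] frechet_derivative_eqI[OF 3] by simp
    moreover have "(\<Sum>b\<in>Basis. (T' \<xi> \<bullet> b) *\<^sub>R frechet_derivative (local_form A d \<alpha> b) (at (snd d x)) (T' \<eta>)) =
        frechet_derivative (local_form A d \<alpha> (\<Sum>b\<in>Basis. (T' \<xi> \<bullet> b) *\<^sub>R b)) (at (snd d x)) (T' \<eta>)"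
      using linear_frechet_derivative_local_form[OF U \<alpha> d(1) dx, of "T' \<eta>"]
      by (simp add: linear_sum[of "\<lambda>\<xi>. frechet_derivative (local_form A d \<alpha> \<xi>) (at (snd d x)) (T' \<eta>)"]
          linear_cmul[of "\<lambda>\<xi>. frechet_derivative (local_form A d \<alpha> \<xi>) (at (snd d x)) (T' \<eta>)"])
    ultimately show ?thesis
      by (simp add: sum.distrib euclidean_representation)
  qed
  show ?thesis
    using sym[of \<xi> \<eta>] unfolding local_ext_deriv_def D T'_def[symmetric] by simp
qed

text \<open>Replaces the pointwise chosen chart by any chart around the point. It applies to the
  smooth forms in degrees 0 and 1; for the form in degree -1 the chosen chart is kept.\<close>

lemma ext_deriv_chart:
  fixes \<alpha> :: "('m, 'e, 'v::euclidean_space) form1"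
  assumes "smooth_form1 A U S \<alpha>" "open U" "c \<in> A" "x \<in> fst c" "x \<in> U"
    "X \<in> tangent_space A x" "Y \<in> tangent_space A x"
  shows "ext_deriv A \<alpha> x X Y = local_ext_deriv A c \<alpha> (snd c x) (X c) (Y c)"
  using local_ext_deriv_change_chart[OF assms(1,2) chart_at assms(3-5)]
    tangent_change_chart[OF chart_at(1) assms(3) chart_at(2) assms(4)] assms(6,7)
  by (simp add: ext_deriv_eq_local)

lemma local_form_in_values:
  "smooth_form1 A U S \<alpha> \<Longrightarrow> c \<in> A \<Longrightarrow> y \<in> snd c ` (fst c \<inter> U) \<Longrightarrow> local_form A c \<alpha> \<xi> y \<in> S"
  by (auto simp: local_form_def chart_inv_chart coord_vec_tangent smooth_form1_values)

lemma local_ext_deriv_in_values: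
  fixes \<alpha> :: "('m, 'e, 'v::euclidean_space) form1"
  assumes "subspace S" "smooth_form1 A U S \<alpha>" "open U" "c \<in> A" "y \<in> snd c ` (fst c \<inter> U)"
  shows "local_ext_deriv A c \<alpha> y \<xi> \<eta> \<in> S"
proof -
  have "frechet_derivative (local_form A c \<alpha> \<xi>) (at y) \<eta> \<in> S" for \<xi> \<eta>
    by (rule frechet_derivative_in_subspace[OF assms(1) open_chart_image[OF assms(4,3)] assms(5)
          local_form_differentiable[OF assms(2,4,5)] local_form_in_values[OF assms(2,4)]])
  then show ?thesis
    using subspace_diff[OF assms(1)] by (simp add: local_ext_deriv_def)
qed

end

section \<open>The soldering form along a section\<close>

lemma differentiable_vec_nth:
  "f differentiable (at x) \<Longrightarrow> (\<lambda>y. f y $ i) differentiable (at x)"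
  by (rule differentiable_bounded_linear[OF bounded_linear_vec_nth])

lemma differentiable_vec_lambda:
  fixes f :: "'n::finite \<Rightarrow> 'a::real_normed_vector \<Rightarrow> real"
  assumes "\<And>i. f i differentiable (at x)"
  shows "(\<lambda>y. \<chi> i. f i y) differentiable (at x)"
  using assms by (subst differentiable_componentwise_within) (auto simp: Basis_vec_def inner_axis)

lemma differentiable_det:
  fixes F :: "'a::real_normed_vector \<Rightarrow> real^'n^'n"
  assumes "\<And>i j. (\<lambda>y. F y $ i $ j) differentiable (at x)"
  shows "(\<lambda>y. det (F y)) differentiable (at x)"
proof -
  have "(\<lambda>y. \<Prod>i\<in>UNIV. F y $ i $ p i) differentiable (at x)" for p :: "'n \<Rightarrow> 'n"
    using has_derivative_prod[of UNIV "\<lambda>i y. F y $ i $ p i", OF assms[unfolded frechet_derivative_works]]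
      unfolding differentiable_def by blast
  then show ?thesis
    unfolding det_def by (intro differentiable_sum differentiable_mult) (auto simp: finite_permutations)
qed

lemma open_det_nonzero: "open {M::real^'n^'n. det M \<noteq> 0}"
proof -
  have "continuous_on UNIV (det :: real^'n^'n \<Rightarrow> real)"
    by (intro differentiable_imp_continuous_on differentiable_at_imp_differentiable_on differentiable_det
        differentiable_vec_nth differentiable_ident)
  then show ?thesis
    by (rule open_Collect_neq) (rule continuous_on_const)
qed

text \<open>Cramer's rule: with b constant, each component of the solution is a quotient of
  determinants in the entries of M, with nonvanishing denominator.\<close>

lemma differentiable_linear_solution:
  fixes M :: "'a::real_normed_vector \<Rightarrow> real^'n^'n"
  assumes "open S" "x \<in> S" "M differentiable (at x)"
    and "\<And>y. y \<in> S \<Longrightarrow> det (M y) \<noteq> 0" "\<And>y. y \<in> S \<Longrightarrow> M y *v N y = b"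
  shows "N differentiable (at x)"
proof -
  have M: "(\<lambda>y. M y $ i $ j) differentiable (at x)" for i j
    by (intro differentiable_vec_nth assms(3))
  have "(\<lambda>y. (\<chi> i j. if j = k then b $ i else M y $ i $ j) $ i $ j) differentiable (at x)" for i j k
    using M by (cases "j = k") auto
  then have "(\<lambda>y. det (\<chi> i j. if j = k then b $ i else M y $ i $ j) / det (M y)) differentiable (at x)" for k
    using assms(2,4) by (intro differentiable_divide differentiable_det M) auto
  then have "(\<lambda>y. \<chi> k. det (\<chi> i j. if j = k then b $ i else M y $ i $ j) / det (M y)) differentiable (at x)"
    by (rule differentiable_vec_lambda)
  moreover have "N y = (\<chi> k. det (\<chi> i j. if j = k then b $ i else M y $ i $ j) / det (M y))" if "y \<in> S" for y
    by (rule cramer[OF assms(4)[OF that], THEN iffD1, OF assms(5)[OF that]])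
  ultimately show ?thesis
    using differentiable_cong_open[OF assms(1,2), of N] by simp
qed

section \<open>Sections of the frame bundle in frame charts\<close>

abbreviation frame_chart :: "('m, real^'n::finite) chart set \<Rightarrow> ('m, real^'n) chart \<Rightarrow>
    ('m \<times> ('m, 'n) frame, (real^'n) \<times> (real^'n^'n)) chart" where
  "frame_chart A c \<equiv> ({(x, u) \<in> frame_bundle A. x \<in> fst c},
     \<lambda>(x, u). (snd c x, matrix (\<lambda>\<xi>. u \<xi> c)))"

lemma frame_atlas_eq: "frame_atlas A = frame_chart A ` A"
  unfolding frame_atlas_def by blast

locale local_frame = smooth_atlas A
  for A :: "('m::{t2_space,second_countable_topology}, real^'n::finite) chart set" +
  fixes P :: "('m \<times> ('m, 'n) frame) set" and U :: "'m set"
    and s :: "'m \<Rightarrow> 'm \<times> ('m, 'n) frame"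
  assumes open_U: "open U" and frames: "P \<subseteq> frame_bundle A" and section_s: "smooth_section A P U s"
begin

lemma fst_section: "x \<in> U \<Longrightarrow> fst (s x) = x"
  using section_s by (simp add: smooth_section_def)

lemma section_frame: "x \<in> U \<Longrightarrow> (x, snd (s x)) \<in> frame_bundle A"
  using section_s frames fst_section[of x] by (metis prod.collapse smooth_section_def subsetD)

lemma linear_frame: "x \<in> U \<Longrightarrow> linear (\<lambda>\<xi>. snd (s x) \<xi> c)"
  using section_frame unfolding frame_bundle_def by blast

lemma matrix_frame: "x \<in> U \<Longrightarrow> matrix (\<lambda>\<xi>. snd (s x) \<xi> c) *v w = snd (s x) w c"
  using linear_frame[of x c] by (simp add: matrix_works)

lemma bij_frame: "x \<in> U \<Longrightarrow> bij_betw (snd (s x)) UNIV (tangent_space A x)"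
  using section_frame unfolding frame_bundle_def by blast

lemma frame_tangent: "x \<in> U \<Longrightarrow> snd (s x) w \<in> tangent_space A x"
  using bij_frame by (auto simp: bij_betw_def)

text \<open>An invertible M is the coordinate matrix of the frame that sends \<xi> to the vector
  with coordinates M \<xi>. Thus the image of a frame chart contains an open set around the points
  of interest, and a derivative involving the chart inverse sees only meaningful values.\<close>

lemma frame_chart_image:
  assumes c: "c \<in> A"
  shows "{(y, M). y \<in> snd c ` fst c \<and> det M \<noteq> 0} \<subseteq> snd (frame_chart A c) ` fst (frame_chart A c)"
proof clarify
  fix x M assume x: "x \<in> fst c" and M: "det (M :: real^'n^'n) \<noteq> 0"
  define u where "u \<xi> = coord_vec A c x (M *v \<xi>)" for \<xi>
  have inj: "inj ((*v) M)" and surj: "surj ((*v) M)"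
    using M by (simp_all add: invertible_det_nz[symmetric] inj_matrix_vector_mult
        invertible_right_inverse matrix_right_invertible_surjective)
  have uc: "u \<xi> c = M *v \<xi>" for \<xi>
    by (simp add: u_def coord_vec_self[OF c x])
  have "linear (\<lambda>\<xi>. u \<xi> d)" for d
  proof (cases "d \<in> A \<and> x \<in> fst d")
    case True
    have "linear (frechet_derivative (snd d \<circ> chart_inv c) (at (snd c x)) \<circ> (*v) M)"
      using True c x differentiable_transition
      by (intro linear_compose linear_frechet_derivative) auto
    then show ?thesis
      using True by (simp add: u_def coord_vec_def o_def)
  next
    case False
    then have "u \<xi> d = 0" for \<xi> by (simp only: u_def coord_vec_def if_False)
    then show ?thesis by (simp add: linear_zero)
  qed
  moreover have "bij_betw u UNIV (tangent_space A x)"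
    unfolding bij_betw_def
  proof
    show "inj u"
      by (rule injI) (metis uc injD[OF inj])
    have "X \<in> range u" if "X \<in> tangent_space A x" for X
    proof -
      obtain \<xi> where "X c = M *v \<xi>" using surj by (metis surjD)
      then have "X = u \<xi>"
        using coord_vec_tangent_eq[OF c x that] by (simp add: u_def)
      then show ?thesis by simp
    qed
    then show "range u = tangent_space A x"
      using coord_vec_tangent[OF c x] by (auto simp: u_def)
  qed
  ultimately have "(x, u) \<in> frame_bundle A"
    unfolding frame_bundle_def by blast
  then have "(x, u) \<in> fst (frame_chart A c)"
    using x by simp
  moreover have "snd (frame_chart A c) (x, u) = (snd c x, M)"
    by (simp add: uc)
  ultimately show "(snd c x, M) \<in> snd (frame_chart A c) ` fst (frame_chart A c)"
    using imageI by fastforce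
qed

lemma section_in_frame_chart: "x \<in> U \<Longrightarrow> s x \<in> fst (frame_chart A c) \<longleftrightarrow> x \<in> fst c"
  using section_frame[of x] fst_section[of x] by (cases "s x") auto

lemma smooth_on_section:
  assumes "c \<in> A" "d \<in> A"
  shows "smooth_on (snd c ` (fst c \<inter> (fst d \<inter> U))) (snd (frame_chart A d) \<circ> s \<circ> chart_inv c)"
proof -
  have "frame_chart A d \<in> frame_atlas A"
    using assms(2) unfolding frame_atlas_eq by (rule imageI)
  then have "smooth_on (snd c ` (fst c \<inter> U \<inter> s -` fst (frame_chart A d)))
      (snd (frame_chart A d) \<circ> s \<circ> chart_inv c)"
    using section_s assms(1) unfolding smooth_section_def smooth_map_on_def by blast
  moreover have "fst c \<inter> U \<inter> s -` fst (frame_chart A d) = fst c \<inter> (fst d \<inter> U)"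
    using section_in_frame_chart by blast
  ultimately show ?thesis by simp
qed

lemma snd_frame_chart_det:
  assumes "c \<in> A" "x \<in> U" "x \<in> fst c"
  shows "det (matrix (\<lambda>\<xi>. snd (s x) \<xi> c)) \<noteq> 0"
proof -
  have "inj (\<lambda>\<xi>. snd (s x) \<xi> c)"
  proof (rule injI)
    fix v w assume "snd (s x) v c = snd (s x) w c"
    then have "snd (s x) v = snd (s x) w"
      by (rule tangent_eqI[OF assms(1,3) frame_tangent[OF assms(2)] frame_tangent[OF assms(2)]])
    then show "v = w"
      using bij_frame[OF assms(2)] by (auto simp: bij_betw_def inj_def)
  qed
  then have "inj ((*v) (matrix (\<lambda>\<xi>. snd (s x) \<xi> c)))"
    using linear_frame[OF assms(2)] by (simp add: matrix_vector_mul)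
  then show ?thesis
    using inj_matrix_vector_mult invertible_det_nz
    by (metis linear_injective_left_inverse matrix_left_invertible_injective invertible_left_inverse)
qed

text \<open>In frame charts the projection forgets the matrix and then applies the transition map
  from c to d, so only the base part of z survives.\<close>

lemma frechet_derivative_bundle_projection:
  assumes "c \<in> A" "d \<in> A" "x \<in> U" "x \<in> fst c" "x \<in> fst d"
  shows "frechet_derivative (snd d \<circ> fst \<circ> chart_inv (frame_chart A c)) (at (snd (frame_chart A c) (s x))) z =
    frechet_derivative (snd d \<circ> chart_inv c) (at (snd c x)) (fst z)"
proof -
  \<comment> \<open>An open set inside the image of the frame chart, where \<open>inv_into\<close>
    is a genuine inverse.\<close>
  let ?O = "{(y, M :: real^'n^'n). y \<in> snd c ` fst c \<and> det M \<noteq> 0}"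
  let ?z = "snd (frame_chart A c) (s x)"
  have O: "?O = (snd c ` fst c) \<times> {M. det M \<noteq> 0}" by auto
  have "open ?O"
    unfolding O using open_chart_image[OF assms(1), of UNIV] by (auto intro: open_Times open_det_nonzero)
  moreover have fz: "fst ?z = snd c x" and "?z \<in> ?O"
    using assms fst_section snd_frame_chart_det by (auto simp: split_beta)
  moreover have "(snd d \<circ> fst \<circ> chart_inv (frame_chart A c)) p = (snd d \<circ> chart_inv c \<circ> fst) p"
    if "p \<in> ?O" for p
  proof -
    have "p \<in> snd (frame_chart A c) ` fst (frame_chart A c)"
      using frame_chart_image[OF assms(1)] that by blast
    then have "chart_inv (frame_chart A c) p \<in> fst (frame_chart A c)"
      "snd (frame_chart A c) (chart_inv (frame_chart A c) p) = p"
      by (rule inv_into_into, rule f_inv_into_f)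
    moreover obtain z u where zu: "chart_inv (frame_chart A c) p = (z, u)"
      by (rule prod.exhaust)
    ultimately have "z \<in> fst c" "snd c z = fst p"
      by auto
    then have "chart_inv c (fst p) = z"
      using chart_inv_chart[OF assms(1)] by metis
    then show ?thesis
      unfolding comp_apply zu by simp
  qed
  ultimately have "frechet_derivative (snd d \<circ> fst \<circ> chart_inv (frame_chart A c)) (at ?z) =
      frechet_derivative ((snd d \<circ> chart_inv c) \<circ> fst) (at ?z)"
    by (intro frechet_derivative_cong_open[of ?O]) auto
  also have "\<dots> = frechet_derivative (snd d \<circ> chart_inv c) (at (fst ?z)) \<circ> fst"
    using differentiable_transition[OF assms(1,2,4,5)] fz
    by (intro frechet_derivative_eqI diff_chain_at)
      (auto simp: frechet_derivative_works intro!: derivative_eq_intros)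
  finally show ?thesis
    by (metis comp_apply fz)
qed

text \<open>The infinitesimal form of the fact that projecting a section gives the identity, carried
  out with the charts that the two tangent maps select.\<close>

lemma tangent_map_section:
  assumes "x \<in> U" "X \<in> tangent_space A x"
  shows "tangent_map (frame_atlas A) A fst (s x) (tangent_map A (frame_atlas A) s x X) = X"
proof
  fix d
  define c where "c = chart_at A x"
  have c: "c \<in> A" "x \<in> fst c" by (simp_all add: c_def chart_at)
  \<comment> \<open>The outer tangent map selects its own chart around \<open>s x\<close>. It is the
    frame chart of some e, which may differ from c.\<close>
  define c' where "c' = chart_at (frame_atlas A) (s x)"
  have "frame_chart A c \<in> frame_atlas A \<and> s x \<in> fst (frame_chart A c)"
    using c section_in_frame_chart[OF assms(1)] unfolding frame_atlas_eq by blast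
  then have c': "c' \<in> frame_atlas A \<and> s x \<in> fst c'"
    unfolding c'_def chart_at_def by (rule someI)
  then obtain e where e: "e \<in> A" "c' = frame_chart A e"
    unfolding frame_atlas_eq by blast
  have xe: "x \<in> fst e"
    using c' e section_in_frame_chart[OF assms(1)] by blast
  have S: "open (snd c ` (fst c \<inter> (fst e \<inter> U)))" "snd c x \<in> snd c ` (fst c \<inter> (fst e \<inter> U))"
    using open_chart_image[OF c(1) open_Int[OF open_chart_domain[OF e(1)] open_U]] c xe assms by auto
  have diff: "(snd c' \<circ> s \<circ> chart_inv c) differentiable (at (snd c x))"
    unfolding e(2) by (rule smooth_on_imp_differentiable[OF smooth_on_section[OF c(1) e(1)] S(2)])
  have "fst (tangent_map A (frame_atlas A) s x X c') =
      fst (frechet_derivative (snd c' \<circ> s \<circ> chart_inv c) (at (snd c x)) (X c))"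
    using c' unfolding tangent_map_def Let_def c_def by simp
  also have "\<dots> = frechet_derivative (\<lambda>y. fst ((snd c' \<circ> s \<circ> chart_inv c) y)) (at (snd c x)) (X c)"
    using frechet_derivative_bounded_linear[OF bounded_linear_fst diff] by simp
  \<comment> \<open>Because s covers the identity, its base component in these charts is the
    transition map from c to e.\<close>
  also have "frechet_derivative (\<lambda>y. fst ((snd c' \<circ> s \<circ> chart_inv c) y)) (at (snd c x)) =
      frechet_derivative (snd e \<circ> chart_inv c) (at (snd c x))"
    using c e fst_section
    by (intro frechet_derivative_cong_open[OF S]) (auto simp: chart_inv_chart split_beta)
  also have "\<dots> (X c) = X e"
    using tangent_change_chart[OF c(1) e(1) c(2) xe assms(2)] by simp
  finally have Xe: "fst (tangent_map A (frame_atlas A) s x X c') = X e" .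
  show "tangent_map (frame_atlas A) A fst (s x) (tangent_map A (frame_atlas A) s x X) d = X d"
  proof (cases "d \<in> A \<and> x \<in> fst d")
    case True
    then have "tangent_map (frame_atlas A) A fst (s x) (tangent_map A (frame_atlas A) s x X) d =
        frechet_derivative (snd d \<circ> fst \<circ> chart_inv c') (at (snd c' (s x)))
          (tangent_map A (frame_atlas A) s x X c')"
      using fst_section[OF assms(1)] by (simp add: tangent_map_def[of "frame_atlas A"] c'_def[symmetric] Let_def)
    also have "\<dots> = frechet_derivative (snd d \<circ> chart_inv e) (at (snd e x)) (X e)"
      using frechet_derivative_bundle_projection[OF e(1) conjunct1[OF True] assms(1) xe
          conjunct2[OF True]] Xe
      by (simp only: e(2))
    also have "\<dots> = X d"
      by (rule tangent_change_chart[OF e(1) conjunct1[OF True] xe conjunct2[OF True] assms(2), symmetric])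
    finally show ?thesis .
  next
    case False
    then have "X d = 0" using assms(2) unfolding tangent_space_def by blast
    then show ?thesis
      using False fst_section[OF assms(1)] unfolding tangent_map_def[of "frame_atlas A"] Let_def by auto
  qed
qed

text \<open>The tangent maps of s and of the projection cancel, so only the inverse frame remains.
  With the next lemma, the pullback at x is the two-sided inverse of the frame
  \<open>snd (s x)\<close>; its later properties are drawn from this.\<close>

lemma frame_pullback_soldering:
  "x \<in> U \<Longrightarrow> X \<in> tangent_space A x \<Longrightarrow> snd (s x) (pullback_soldering A s x X) = X"
  using bij_frame[of x] tangent_map_section[of x X]
  by (simp add: pullback_soldering_def soldering_def bij_betw_inv_into_right)

lemma pullback_soldering_frame: "x \<in> U \<Longrightarrow> pullback_soldering A s x (snd (s x) w) = w"
  using frame_pullback_soldering[OF _ frame_tangent, of x w] bij_frame[of x]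
  by (auto simp: bij_betw_def dest: injD)

lemma smooth_on_frame_coordinate:
  assumes "c \<in> A"
  shows "smooth_on (snd c ` (fst c \<inter> U)) (\<lambda>y. matrix (\<lambda>\<xi>. snd (s (chart_inv c y)) \<xi> c))"
    (is "smooth_on ?S _")
proof -
  have S: "open ?S" by (rule open_chart_image[OF assms open_U])
  have "smooth_on ?S (snd (frame_chart A c) \<circ> s \<circ> chart_inv c)"
    using smooth_on_section[OF assms assms] by simp
  then have "smooth_on ?S (\<lambda>y. snd ((snd (frame_chart A c) \<circ> s \<circ> chart_inv c) y))"
    by (rule smooth_on_bounded_linear[OF S bounded_linear_snd])
  then show ?thesis by (simp add: split_beta)
qed

lemma smooth_on_frame_vector:
  assumes "c \<in> A"
  shows "smooth_on (snd c ` (fst c \<inter> U)) (\<lambda>y. snd (s (chart_inv c y)) w c)" (is "smooth_on ?S _")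
proof -
  have S: "open ?S" by (rule open_chart_image[OF assms open_U])
  have lin: "linear (\<lambda>M :: real^'n^'n. M *v w)"
    by (intro linearI) (simp_all add: matrix_vector_mult_add_rdistrib scaleR_matrix_vector_assoc)
  have "smooth_on ?S (\<lambda>y. matrix (\<lambda>\<xi>. snd (s (chart_inv c y)) \<xi> c) *v w)"
    by (rule smooth_on_linear[OF S lin smooth_on_frame_coordinate[OF assms]])
  moreover have "matrix (\<lambda>\<xi>. snd (s (chart_inv c y)) \<xi> c) *v w = snd (s (chart_inv c y)) w c"
    if "y \<in> ?S" for y
    using that assms matrix_frame[where c = c] by (auto simp: chart_inv_chart)
  ultimately show ?thesis
    using smooth_on_cong[OF S] by (metis (no_types, lifting))
qed

text \<open>The components of a coordinate vector in the moving frame solve a linear system whose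
  matrix is the frame in coordinates. First order suffices, as the pullback is differentiated only
  once below.\<close>

lemma differentiable_pullback_soldering:
  assumes c: "c \<in> A" and y: "y \<in> snd c ` (fst c \<inter> U)"
  shows "local_form A c (pullback_soldering A s) \<xi> differentiable (at y)"
proof (rule differentiable_linear_solution[OF open_chart_image[OF c open_U] y])
  show "(\<lambda>y. matrix (\<lambda>\<xi>. snd (s (chart_inv c y)) \<xi> c)) differentiable (at y)"
    by (rule smooth_on_imp_differentiable[OF smooth_on_frame_coordinate[OF c] y])
next
  fix y assume "y \<in> snd c ` (fst c \<inter> U)"
  then obtain x where x: "x \<in> fst c" "x \<in> U" "y = snd c x" by auto
  show "det (matrix (\<lambda>\<xi>. snd (s (chart_inv c y)) \<xi> c)) \<noteq> 0"
    using snd_frame_chart_det[OF c x(2,1)] x c by (simp add: chart_inv_chart)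
  show "matrix (\<lambda>\<xi>. snd (s (chart_inv c y)) \<xi> c) *v local_form A c (pullback_soldering A s) \<xi> y = \<xi>"
    using x c matrix_frame[OF x(2)] frame_pullback_soldering[OF x(2) coord_vec_tangent[OF c x(1)]]
    by (simp add: local_form_def chart_inv_chart coord_vec_self)
qed

end

section \<open>Identities in a graded Lie algebra\<close>

locale graded_bracket =
  fixes br :: "'l::euclidean_space \<Rightarrow> 'l \<Rightarrow> 'l" and \<hh> :: "int \<Rightarrow> 'l set"
  assumes lie: "lie_algebra br" and graded: "graded_lie_algebra br \<hh>"
begin

lemma bilinear_br: "bilinear br"
  using lie by (simp add: lie_algebra_def)

lemma bounded_bilinear_br: "bounded_bilinear br"
  using bilinear_br by (simp add: bilinear_conv_bounded_bilinear)

lemmas br_simps = bilinear_ladd[OF bilinear_br] bilinear_radd[OF bilinear_br]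
  bilinear_lsub[OF bilinear_br] bilinear_rsub[OF bilinear_br]
  bilinear_lneg[OF bilinear_br] bilinear_rneg[OF bilinear_br]
  bilinear_lmul[OF bilinear_br] bilinear_rmul[OF bilinear_br]
  bilinear_lzero[OF bilinear_br] bilinear_rzero[OF bilinear_br]

lemma br_self: "br x x = 0"
  using lie by (simp add: lie_algebra_def)

lemma br_commute: "br x y = - br y x"
  using br_self[of "x + y"] by (simp add: br_simps br_self[of x] br_self[of y] eq_neg_iff_add_eq_0 add.commute)

lemma jacobi: "br (br x y) z + br (br y z) x + br (br z x) y = 0"
proof -
  have "br x (br y z) + br y (br z x) + br z (br x y) = 0"
    using lie unfolding lie_algebra_def by blast
  then show ?thesis
    by (simp add: br_commute[of "br _ _"] algebra_simps neg_eq_iff_add_eq_0 add_eq_0_iff)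
qed

lemma br_derivation: "br (br x y) p = br (br x p) y + br x (br y p)"
  using jacobi[of x y p] br_commute[of "br y p" x] br_commute[of p x]
  by (simp add: br_simps algebra_simps add_eq_0_iff)

lemma subspace_grade: "subspace (\<hh> r)"
  using graded by (simp add: graded_lie_algebra_def)

lemma br_grade: "x \<in> \<hh> r \<Longrightarrow> y \<in> \<hh> t \<Longrightarrow> br x y \<in> \<hh> (r + t)"
  using graded by (simp add: graded_lie_algebra_def)

lemma br_eq_0:
  assumes "x \<in> \<hh> r" "y \<in> \<hh> t" "r + t \<notin> {-1, 0, 1}"
  shows "br x y = 0"
proof -
  have "\<hh> (r + t) = {0}"
    using graded assms(3) by (simp add: graded_lie_algebra_def)
  then show ?thesis
    using br_grade[OF assms(1,2)] by simp
qed

text \<open>Pairing with an arbitrary z turns an identity between sums of brackets into a linear one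
  between real numbers, which arithmetic can settle with the expanded brackets as atoms.\<close>

lemma inner_eqI: "(\<And>z. x \<bullet> z = y \<bullet> z) \<Longrightarrow> x = (y :: 'l)"
  by (rule euclidean_eqI)

text \<open>In the next lemmas \<open>t, a, b\<close> stand for \<open>\<omega>\<^sup>-\<^sup>1, \<omega>\<^sup>0, \<omega>\<^sup>1\<close> evaluated at one tangent vector,
  and \<open>T, A, B\<close> for their exterior derivatives at two of them. Since \<open>D = [-, p]\<close> is a
  derivation with \<open>D\<^sup>3 = 0\<close>, the primed quantities are the components of \<open>exp D\<close> applied to the
  unprimed ones, plus the contribution of the differential of \<open>p\<close>.\<close>

context
  fixes tX tY aX aY bX bY p pX pY T A aX' aY' bX' bY' A' :: 'l
  assumes grade_t: "tX \<in> \<hh> (-1)" "tY \<in> \<hh> (-1)" and grade_a: "aX \<in> \<hh> 0" "aY \<in> \<hh> 0"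
    and grade_b: "bX \<in> \<hh> 1" "bY \<in> \<hh> 1" and grade_p: "p \<in> \<hh> 1" "pX \<in> \<hh> 1" "pY \<in> \<hh> 1"
    and T: "T = - (br tX aY - br tY aX)"
    and A: "A + br aX aY = - (br tX bY - br tY bX)"
    and a': "aX' = aX + br tX p" "aY' = aY + br tY p"
    and b': "bX' = bX + pX + (1/2) *\<^sub>R br (aX + aX') p" "bY' = bY + pY + (1/2) *\<^sub>R br (aY + aY') p"
    and A': "A' = A + br T p + br tY pX - br tX pY"
begin

private lemma D_grade:
  "br tX p \<in> \<hh> 0" "br tY p \<in> \<hh> 0" "br (br tX p) p \<in> \<hh> 1" "br (br tY p) p \<in> \<hh> 1"
  "br aX p \<in> \<hh> 1" "br aY p \<in> \<hh> 1"
proof -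
  show u: "br tX p \<in> \<hh> 0" "br tY p \<in> \<hh> 0"
    using br_grade[OF grade_t(1) grade_p(1)] br_grade[OF grade_t(2) grade_p(1)] by simp_all
  show "br (br tX p) p \<in> \<hh> 1" "br (br tY p) p \<in> \<hh> 1" "br aX p \<in> \<hh> 1" "br aY p \<in> \<hh> 1"
    using br_grade[OF u(1) grade_p(1)] br_grade[OF u(2) grade_p(1)]
      br_grade[OF grade_a(1) grade_p(1)] br_grade[OF grade_a(2) grade_p(1)] by simp_all
qed

private lemma D_top: "x \<in> \<hh> 1 \<Longrightarrow> br x p = 0"
  by (rule br_eq_0[of _ 1, OF _ grade_p(1)]) simp_all

text \<open>[tX, tY] has degree -2 and vanishes; \<open>D1\<close>, \<open>D2\<close> and
  \<open>D3\<close> come from applying D to it once, twice and three times by the Leibniz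
  rule.\<close>

private lemma D1: "br (br tX p) tY + br tX (br tY p) = 0"
proof -
  have "br tX tY = 0" by (rule br_eq_0[OF grade_t]) simp
  then show ?thesis using br_derivation[of tX tY p] by (simp add: br_simps)
qed

private lemma D2:
  "br (br (br tX p) p) tY + 2 *\<^sub>R br (br tX p) (br tY p) + br tX (br (br tY p) p) = 0"
proof -
  have "br (br (br tX p) tY + br tX (br tY p)) p = 0"
    by (simp add: D1 br_simps)
  then show ?thesis
    by (simp add: br_simps br_derivation[of "br tX p" tY p] br_derivation[of tX "br tY p" p]
        scaleR_2 algebra_simps)
qed

text \<open>In the third derivative the terms with D^3 tX and D^3 tY vanish by degree; the two
  middle terms both carry the binomial coefficient 3, which is divided out.\<close>

private lemma D3: "br (br (br tX p) p) (br tY p) + br (br tX p) (br (br tY p) p) = 0"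
proof -
  have three: "3 *\<^sub>R v = v + v + v" for v :: 'l
    using scaleR_add_left[of 2 1 v] by (simp add: scaleR_2)
  have "br (br (br (br tX p) p) tY) p = br (br (br tX p) p) (br tY p)"
    using br_derivation[of "br (br tX p) p" tY p] D_top[OF D_grade(3)] by (simp add: br_simps)
  moreover have "br (br (br tX p) (br tY p)) p =
      br (br (br tX p) p) (br tY p) + br (br tX p) (br (br tY p) p)"
    by (rule br_derivation)
  moreover have "br (br tX (br (br tY p) p)) p = br (br tX p) (br (br tY p) p)"
    using br_derivation[of tX "br (br tY p) p" p] D_top[OF D_grade(4)] by (simp add: br_simps)
  moreover have "br (br (br (br tX p) p) tY + 2 *\<^sub>R br (br tX p) (br tY p) +
      br tX (br (br tY p) p)) p = 0"
    by (simp only: D2 br_simps)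
  ultimately have "3 *\<^sub>R (br (br (br tX p) p) (br tY p) + br (br tX p) (br (br tY p) p)) = 0"
    by (simp add: bilinear_ladd[OF bilinear_br] bilinear_lmul[OF bilinear_br] scaleR_2 three algebra_simps)
  then show ?thesis by simp
qed

text \<open>\<open>DT\<close> and \<open>DDT\<close> apply D once and twice to the torsion equation
  \<open>T\<close>, and \<open>DA\<close> applies D to the structure equation \<open>A\<close>.
  Since D kills degree 1, the terms D^2 aX, D^2 aY, D bX and D bY drop out.\<close>

private lemma DT: "br T p =
    - (br (br tX p) aY + br tX (br aY p)) + (br (br tY p) aX + br tY (br aX p))"
  unfolding T by (simp add: br_simps br_derivation[of tX aY p] br_derivation[of tY aX p])

private lemma DDT: "br (br T p) p =
    - (br (br (br tX p) p) aY + 2 *\<^sub>R br (br tX p) (br aY p))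
    + (br (br (br tY p) p) aX + 2 *\<^sub>R br (br tY p) (br aX p))"
  using D_top[OF D_grade(5)] D_top[OF D_grade(6)] unfolding DT
  by (simp add: br_simps br_derivation[of "br tX p" aY p] br_derivation[of "br tY p" aX p]
      br_derivation[of tX "br aY p" p] br_derivation[of tY "br aX p" p] scaleR_2)

private lemma DA: "br A p + br (br aX p) aY + br aX (br aY p) =
    - (br (br tX p) bY - br (br tY p) bX)"
proof -
  have "br (A + br aX aY) p = br (- (br tX bY - br tY bX)) p"
    using A by simp
  then show ?thesis
    using D_top grade_b
    by (simp add: br_simps br_derivation[of aX aY p] br_derivation[of tX bY p]
        br_derivation[of tY bX p] algebra_simps)
qed

text \<open>Sorted by the order in p: order 0 is \<open>A\<close>, order 1 is \<open>DT\<close>,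
  order 2 is half of \<open>D2\<close>, and the terms in pX and pY cancel. Order 2 is what forces
  the coefficient 1/2 in b'.\<close>

lemma gauge_structure:
  "A' + br aX' aY' =
    - (br tX bY' - br tY bX')"
proof (rule inner_eqI)
  fix z
  show "(A' + br aX' aY') \<bullet> z =
    (- (br tX bY' - br tY bX')) \<bullet> z"
    using arg_cong[OF A, of "\<lambda>v. v \<bullet> z"] arg_cong[OF D2, of "\<lambda>v. v \<bullet> z"]
      arg_cong[OF DT, of "\<lambda>v. v \<bullet> z"]
    unfolding A' a' b'
    by (simp add: br_simps inner_simps br_commute[of "br (br tX p) p" tY] br_commute[of "br tY p" aX]) argo
qed

text \<open>The hypothesis is the exterior derivative of b', with d d p = 0. Sorted by the order in
  p, order 1 vanishes by \<open>DA\<close>, order 2 by half of \<open>DDT\<close>, order 3 by half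
  of \<open>D3\<close>; the terms in pX and pY cancel because D pX = D pY = 0.\<close>

lemma gauge_curvature:
  assumes B': "B' = B + (1/2) *\<^sub>R (br (A + A') p + br (aY + aY') pX - br (aX + aX') pY)"
  shows "B' + (br aX' bY' - br aY' bX') = B + (br aX bY - br aY bX)"
proof (rule inner_eqI)
  fix z
  have "br (br tX pY) p = br (br tX p) pY" "br (br tY pX) p = br (br tY p) pX"
    using D_top grade_p br_derivation[of tX pY p] br_derivation[of tY pX p] by (simp_all add: br_simps)
  then show "(B' + (br aX' bY' -
      br aY' bX')) \<bullet> z = (B + (br aX bY - br aY bX)) \<bullet> z"
    using arg_cong[OF DA, of "\<lambda>v. v \<bullet> z"] arg_cong[OF D3, of "\<lambda>v. v \<bullet> z"]
      arg_cong[OF DDT, of "\<lambda>v. v \<bullet> z"]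
    unfolding B' A' a' b'
    by (simp add: br_simps inner_simps br_commute[of "br (br tX p) p" aY] br_commute[of "br (br tY p) p" aX]
        br_commute[of "br aX p" aY] br_commute[of "br (br tX p) p" "br tY p"]) argo
qed

end

text \<open>The hypothesis \<open>d\<close> is what d d \<omega>0 = 0 yields. Once the structure
  equations replace A and T, the triple brackets of the a's cancel by Jacobi, and \<open>J\<close>
  rewrites each [[a, b], t] through [[t, b], a] and [[t, a], b].\<close>

lemma bianchi_algebra:
  fixes t a b :: "nat \<Rightarrow> 'l" and T A B :: "nat \<Rightarrow> nat \<Rightarrow> 'l"
  assumes A: "A 1 2 + br (a 1) (a 2) = - (br (t 1) (b 2) - br (t 2) (b 1))"
      "A 2 3 + br (a 2) (a 3) = - (br (t 2) (b 3) - br (t 3) (b 2))"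
      "A 3 1 + br (a 3) (a 1) = - (br (t 3) (b 1) - br (t 1) (b 3))"
    and T: "T 1 2 = - (br (t 1) (a 2) - br (t 2) (a 1))"
      "T 2 3 = - (br (t 2) (a 3) - br (t 3) (a 2))"
      "T 3 1 = - (br (t 3) (a 1) - br (t 1) (a 3))"
    and d: "br (A 1 2) (a 3) + br (A 2 3) (a 1) + br (A 3 1) (a 2) =
      - (br (T 1 2) (b 3) + br (T 2 3) (b 1) + br (T 3 1) (b 2) +
        br (B 1 2) (t 3) + br (B 2 3) (t 1) + br (B 3 1) (t 2))"
  shows "br (B 1 2 + (br (a 1) (b 2) - br (a 2) (b 1))) (t 3) +
      br (B 2 3 + (br (a 2) (b 3) - br (a 3) (b 2))) (t 1) +
      br (B 3 1 + (br (a 3) (b 1) - br (a 1) (b 3))) (t 2) = 0"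
proof (rule inner_eqI)
  fix z
  have A': "A 1 2 = - (br (t 1) (b 2) - br (t 2) (b 1)) - br (a 1) (a 2)"
    "A 2 3 = - (br (t 2) (b 3) - br (t 3) (b 2)) - br (a 2) (a 3)"
    "A 3 1 = - (br (t 3) (b 1) - br (t 1) (b 3)) - br (a 3) (a 1)"
    using A by (simp_all add: eq_diff_eq)
  have J: "br (br (a i) (b j)) (t k) \<bullet> z = br (br (t k) (b j)) (a i) \<bullet> z - br (br (t k) (a i)) (b j) \<bullet> z" for i j k
    using arg_cong[OF jacobi[of "a i" "b j" "t k"], of "\<lambda>v. v \<bullet> z"] br_commute[of "b j" "t k"]
    by (simp add: br_simps inner_simps)
  show "(br (B 1 2 + (br (a 1) (b 2) - br (a 2) (b 1))) (t 3) +
      br (B 2 3 + (br (a 2) (b 3) - br (a 3) (b 2))) (t 1) +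
      br (B 3 1 + (br (a 3) (b 1) - br (a 1) (b 3))) (t 2)) \<bullet> z = 0 \<bullet> z"
    using arg_cong[OF d[unfolded A' T], of "\<lambda>v. v \<bullet> z"] arg_cong[OF jacobi[of "a 1" "a 2" "a 3"], of "\<lambda>v. v \<bullet> z"]
    by (simp add: br_simps inner_simps J)
qed

end

section \<open>Operations on forms\<close>

context smooth_atlas
begin

lemma local_form_cong:
  assumes "c \<in> A" "y \<in> snd c ` (fst c \<inter> U)"
    "\<And>x X. x \<in> U \<Longrightarrow> X \<in> tangent_space A x \<Longrightarrow> \<alpha> x X = \<beta> x X"
  shows "local_form A c \<alpha> \<xi> y = local_form A c \<beta> \<xi> y"
  using assms coord_vec_tangent[OF assms(1)] by (auto simp: local_form_def chart_inv_chart)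

lemma local_ext_deriv_cong:
  assumes "open U" "c \<in> A" "y \<in> snd c ` (fst c \<inter> U)"
    "\<And>x X. x \<in> U \<Longrightarrow> X \<in> tangent_space A x \<Longrightarrow> \<alpha> x X = \<beta> x X"
  shows "local_ext_deriv A c \<alpha> y \<xi> \<eta> = local_ext_deriv A c \<beta> y \<xi> \<eta>"
proof -
  have "frechet_derivative (local_form A c \<alpha> \<zeta>) (at y) = frechet_derivative (local_form A c \<beta> \<zeta>) (at y)" for \<zeta>
    using assms by (intro frechet_derivative_cong_open[OF open_chart_image assms(3)] local_form_cong)
  then show ?thesis by (simp add: local_ext_deriv_def)
qed

lemma local_ext_deriv_add:
  assumes "\<And>\<zeta>. local_form A c \<alpha> \<zeta> differentiable (at y)" "\<And>\<zeta>. local_form A c \<beta> \<zeta> differentiable (at y)"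
  shows "local_ext_deriv A c (\<lambda>x X. \<alpha> x X + \<beta> x X) y \<xi> \<eta> =
    local_ext_deriv A c \<alpha> y \<xi> \<eta> + local_ext_deriv A c \<beta> y \<xi> \<eta>"
proof -
  have "local_form A c (\<lambda>x X. \<alpha> x X + \<beta> x X) \<zeta> = (\<lambda>y. local_form A c \<alpha> \<zeta> y + local_form A c \<beta> \<zeta> y)" for \<zeta>
    by (simp add: local_form_def[abs_def])
  then show ?thesis
    using assms by (simp add: local_ext_deriv_def frechet_derivative_add)
qed

lemma local_ext_deriv_scaleR:
  assumes "\<And>\<zeta>. local_form A c \<alpha> \<zeta> differentiable (at y)"
  shows "local_ext_deriv A c (\<lambda>x X. r *\<^sub>R \<alpha> x X) y \<xi> \<eta> = r *\<^sub>R local_ext_deriv A c \<alpha> y \<xi> \<eta>"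
proof -
  have "local_form A c (\<lambda>x X. r *\<^sub>R \<alpha> x X) \<zeta> = (\<lambda>y. r *\<^sub>R local_form A c \<alpha> \<zeta> y)" for \<zeta>
    by (simp add: local_form_def[abs_def])
  then show ?thesis
    using assms
    by (simp add: local_ext_deriv_def scaleR_diff_right
        frechet_derivative_bounded_linear[OF bounded_linear_scaleR_right])
qed

lemma local_ext_deriv_bilinear:
  assumes br: "bounded_bilinear br"
    and \<alpha>: "\<And>\<zeta>. local_form A c \<alpha> \<zeta> differentiable (at y)" and g: "(g \<circ> chart_inv c) differentiable (at y)"
  shows "local_ext_deriv A c (\<lambda>x X. br (\<alpha> x X) (g x)) y \<xi> \<eta> =
    br (local_ext_deriv A c \<alpha> y \<xi> \<eta>) (g (chart_inv c y)) +
    br (local_form A c \<alpha> \<eta> y) (frechet_derivative (g \<circ> chart_inv c) (at y) \<xi>) -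
    br (local_form A c \<alpha> \<xi> y) (frechet_derivative (g \<circ> chart_inv c) (at y) \<eta>)"
proof -
  have "local_form A c (\<lambda>x X. br (\<alpha> x X) (g x)) \<zeta> = (\<lambda>y. br (local_form A c \<alpha> \<zeta> y) ((g \<circ> chart_inv c) y))" for \<zeta>
    by (simp add: local_form_def[abs_def])
  then show ?thesis
    using frechet_derivative_bounded_bilinear[OF br \<alpha> g] bounded_bilinear.diff_left[OF br]
    by (simp add: local_ext_deriv_def)
qed

text \<open>d d f = 0 is the symmetry of the second derivatives of f read in the fixed
  chart.\<close>

lemma local_ext_deriv_differential:
  fixes f :: "'m \<Rightarrow> 'f::euclidean_space"
  assumes f: "smooth_map_on U A eucl_atlas f" and U: "open U" and c: "c \<in> A" "y \<in> snd c ` (fst c \<inter> U)"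
  shows "local_ext_deriv A c (differential A f) y \<xi> \<eta> = 0"
proof -
  note S = open_chart_image[OF c(1) U]
  have "frechet_derivative (local_form A c (differential A f) \<zeta>) (at y) =
      frechet_derivative (\<lambda>y. frechet_derivative (f \<circ> chart_inv c) (at y) \<zeta>) (at y)" for \<zeta>
    by (rule frechet_derivative_cong_open[OF S c(2) local_form_differential[OF f c(1)]])
  then show ?thesis
    using frechet_derivative_commute[OF S c(2) smooth_map_on_euclD[OF f c(1)], of \<eta> \<xi>]
    by (simp add: local_ext_deriv_def)
qed

lemma smooth_form1_add:
  fixes \<alpha> \<beta> :: "('m, 'e, 'v::euclidean_space) form1"
  assumes "subspace V" "open U" "smooth_form1 A U V \<alpha>" "smooth_form1 A U V \<beta>"
  shows "smooth_form1 A U V (\<lambda>x X. \<alpha> x X + \<beta> x X)"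
  unfolding smooth_form1_def
proof (intro conjI ballI allI)
  fix c \<xi> assume c: "c \<in> A"
  show "smooth_on (snd c ` (fst c \<inter> U)) (\<lambda>y. \<alpha> (chart_inv c y) (coord_vec A c (chart_inv c y) \<xi>) +
      \<beta> (chart_inv c y) (coord_vec A c (chart_inv c y) \<xi>))"
    using smooth_on_add[OF open_chart_image[OF c assms(2)] smooth_form1_smooth_on[OF assms(3) c]
        smooth_form1_smooth_on[OF assms(4) c]]
    by (simp add: local_form_def[abs_def])
qed (use assms in \<open>simp_all add: smooth_form1_values smooth_form1_combination subspace_add algebra_simps\<close>)

lemma smooth_form1_scaleR:
  fixes \<alpha> :: "('m, 'e, 'v::euclidean_space) form1"
  assumes "subspace V" "open U" "smooth_form1 A U V \<alpha>"
  shows "smooth_form1 A U V (\<lambda>x X. r *\<^sub>R \<alpha> x X)"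
  unfolding smooth_form1_def
proof (intro conjI ballI allI)
  fix c \<xi> assume c: "c \<in> A"
  show "smooth_on (snd c ` (fst c \<inter> U)) (\<lambda>y. r *\<^sub>R \<alpha> (chart_inv c y) (coord_vec A c (chart_inv c y) \<xi>))"
    using smooth_on_bounded_linear[OF open_chart_image[OF c assms(2)] bounded_linear_scaleR_right
        smooth_form1_smooth_on[OF assms(3) c]]
    by (simp add: local_form_def[abs_def])
qed (use assms in \<open>simp_all add: smooth_form1_values smooth_form1_combination subspace_scale algebra_simps\<close>)

lemma smooth_form1_bilinear:
  fixes \<alpha> :: "('m, 'e, 'v::euclidean_space) form1" and g :: "'m \<Rightarrow> 'v" and br :: "'v \<Rightarrow> 'v \<Rightarrow> 'v"
  assumes br: "bounded_bilinear br" and U: "open U" and \<alpha>: "smooth_form1 A U V \<alpha>"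
    and g: "smooth_map_on U A eucl_atlas g"
    and V: "\<And>x v. x \<in> U \<Longrightarrow> v \<in> V \<Longrightarrow> br v (g x) \<in> V'"
  shows "smooth_form1 A U V' (\<lambda>x X. br (\<alpha> x X) (g x))"
  unfolding smooth_form1_def
proof (intro conjI ballI allI)
  fix c \<xi> assume c: "c \<in> A"
  show "smooth_on (snd c ` (fst c \<inter> U))
      (\<lambda>y. br (\<alpha> (chart_inv c y) (coord_vec A c (chart_inv c y) \<xi>)) (g (chart_inv c y)))"
    using smooth_on_bounded_bilinear[OF open_chart_image[OF c U] br
        smooth_form1_smooth_on[OF \<alpha> c] smooth_map_on_euclD[OF g c]]
    by (simp add: local_form_def[abs_def])
qed (use assms in \<open>simp_all add: smooth_form1_values smooth_form1_combination
    bounded_bilinear.add_left[OF br] bounded_bilinear.scaleR_left[OF br]\<close>)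

lemma smooth_map_on_minus:
  fixes f :: "'m \<Rightarrow> 'f::euclidean_space"
  assumes "open U" "smooth_map_on U A eucl_atlas f"
  shows "smooth_map_on U A eucl_atlas (\<lambda>x. - f x)"
proof (rule smooth_map_on_euclI[OF assms(1)])
  fix c assume c: "c \<in> A"
  show "smooth_on (snd c ` (fst c \<inter> U)) ((\<lambda>x. - f x) \<circ> chart_inv c)"
    using smooth_on_minus[OF open_chart_image[OF c assms(1)] smooth_map_on_euclD[OF assms(2) c]]
    by (simp add: o_def)
qed

lemma coord_form:
  assumes "c \<in> A" "x \<in> fst c" "X \<in> tangent_space A x"
  shows "local_form A c \<alpha> (X c) (snd c x) = \<alpha> x X"
  using assms by (simp add: local_form_def chart_inv_chart coord_vec_tangent_eq)

end

text \<open>Smoothness of Q is known for fixed arguments only. Moving arguments, such as frame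
  vectors, are expanded in the standard basis, leaving a finite sum of products of smooth
  functions.\<close>

lemma smooth_on_bilinear_family:
  fixes Q :: "'a::euclidean_space \<Rightarrow> 'a \<Rightarrow> 'a \<Rightarrow> 'l::euclidean_space"
  assumes S: "open S" and Q: "\<And>\<xi> \<eta>. smooth_on S (\<lambda>y. Q y \<xi> \<eta>)" "\<And>y. y \<in> S \<Longrightarrow> bilinear (Q y)"
    and FG: "smooth_on S F" "smooth_on S G"
  shows "smooth_on S (\<lambda>y. Q y (F y) (G y))"
proof -
  have "smooth_on S (\<lambda>y. \<Sum>b\<in>Basis. \<Sum>b'\<in>Basis. (F y \<bullet> b) *\<^sub>R ((G y \<bullet> b') *\<^sub>R Q y b b'))"
    by (intro smooth_on_sum[OF S] smooth_on_bounded_bilinear[OF S bounded_bilinear_scaleR]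
        smooth_on_bounded_linear[OF S bounded_linear_inner_left] Q(1) FG)
  moreover have "Q y (F y) (G y) = (\<Sum>b\<in>Basis. \<Sum>b'\<in>Basis. (F y \<bullet> b) *\<^sub>R ((G y \<bullet> b') *\<^sub>R Q y b b'))"
    if "y \<in> S" for y
  proof -
    have "Q y (F y) (G y) = Q y (\<Sum>b\<in>Basis. (F y \<bullet> b) *\<^sub>R b) (\<Sum>b'\<in>Basis. (G y \<bullet> b') *\<^sub>R b')"
      by (simp add: euclidean_representation)
    then show ?thesis
      using bilinear_sum[OF Q(2)[OF that], of "\<lambda>b. (F y \<bullet> b) *\<^sub>R b" Basis "\<lambda>b. (G y \<bullet> b) *\<^sub>R b" Basis]
        Q(2)[OF that]
      by (simp add: sum.cartesian_product split_beta bilinear_lmul bilinear_rmul)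
  qed
  ultimately show ?thesis
    using smooth_on_cong[OF S] by (metis (no_types, lifting))
qed

section \<open>Admissible tuples and their curvature\<close>

locale admissible_frame = local_frame A P U s + graded_bracket br \<hh>
  for A :: "('m::{t2_space,second_countable_topology}, real^'n::finite) chart set"
    and P U s and br :: "'l::euclidean_space \<Rightarrow> 'l \<Rightarrow> 'l" and \<hh> +
  fixes j :: "real^'n \<Rightarrow> 'l"
  assumes linear_j: "linear j" and j_grade: "\<And>w. j w \<in> \<hh> (-1)"
begin

abbreviation \<theta> :: "('m, real^'n, 'l) form1" where
  "\<theta> \<equiv> omega_minus A j s"

lemma theta_frame: "x \<in> U \<Longrightarrow> \<theta> x (snd (s x) w) = j w"
  by (simp add: omega_minus_def pullback_soldering_frame)

lemma theta_grade: "\<theta> x X \<in> \<hh> (-1)"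
  by (simp add: omega_minus_def j_grade)

lemma differentiable_theta:
  assumes "c \<in> A" "y \<in> snd c ` (fst c \<inter> U)"
  shows "local_form A c \<theta> \<xi> differentiable (at y)"
proof -
  have "local_form A c \<theta> \<xi> = (\<lambda>y. j (local_form A c (pullback_soldering A s) \<xi> y))"
    by (simp add: local_form_def[abs_def] omega_minus_def)
  then show ?thesis
    using differentiable_bounded_linear[OF _ differentiable_pullback_soldering[OF assms]]
      linear_j by (simp add: linear_conv_bounded_linear)
qed

text \<open>Although defined through the derivative of the section, the form at x is determined by
  the frame at x alone, being its inverse followed by j. Hence equality of the sections at the
  single point x is enough.\<close>

lemma omega_minus_section_cong:
  assumes "smooth_section A P U s'" "x \<in> U" "s x = s' x" "X \<in> tangent_space A x"
  shows "omega_minus A j s' x X = \<theta> x X"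
proof -
  interpret s': local_frame A P U s'
    using open_U frames assms(1) by unfold_locales
  have "pullback_soldering A s' x X = pullback_soldering A s x X"
    using s'.pullback_soldering_frame[OF assms(2)] frame_pullback_soldering[OF assms(2,4)] assms(3)
    by metis
  then show ?thesis by (simp add: omega_minus_def)
qed

text \<open>Restricted to the chart that \<open>ext_deriv\<close> selects at x, where its definition
  unfolds directly; chart independence is established for smooth forms, and \<theta> is known to be
  differentiable.\<close>

lemma admissible2_local:
  assumes "admissible2 A P U br \<hh> j (s, \<omega>0)" and x: "x \<in> U"
  defines "c \<equiv> chart_at A x"
  shows "local_ext_deriv A c \<theta> (snd c x) \<xi> \<eta> =
    - (br (local_form A c \<theta> \<xi> (snd c x)) (local_form A c \<omega>0 \<eta> (snd c x))
       - br (local_form A c \<theta> \<eta> (snd c x)) (local_form A c \<omega>0 \<xi> (snd c x)))"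
proof -
  have c: "c \<in> A" "x \<in> fst c" by (simp_all add: c_def chart_at)
  have "ext_deriv A \<theta> x (coord_vec A c x \<xi>) (coord_vec A c x \<eta>) =
      - form_bracket br \<theta> \<omega>0 x (coord_vec A c x \<xi>) (coord_vec A c x \<eta>)"
    using assms(1) x coord_vec_tangent[OF c] by (simp add: admissible2_def)
  then show ?thesis
    using c by (simp add: ext_deriv_eq_local c_def[symmetric] coord_vec_self form_bracket_def
        local_form_def chart_inv_chart)
qed

lemma admissible3_local:
  assumes "admissible3 A P U br \<hh> j (s, \<omega>0, \<omega>1)" and c: "c \<in> A" and y: "y \<in> snd c ` (fst c \<inter> U)"
  shows "local_ext_deriv A c \<omega>0 y \<xi> \<eta> + br (local_form A c \<omega>0 \<xi> y) (local_form A c \<omega>0 \<eta> y) =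
    - (br (local_form A c \<theta> \<xi> y) (local_form A c \<omega>1 \<eta> y)
       - br (local_form A c \<theta> \<eta> y) (local_form A c \<omega>1 \<xi> y))"
proof -
  obtain x where x: "x \<in> fst c" "x \<in> U" "y = snd c x" using y by auto
  let ?X = "coord_vec A c x \<xi>" and ?Y = "coord_vec A c x \<eta>"
  have \<omega>0: "smooth_form1 A U (\<hh> 0) \<omega>0"
    using assms(1) by (simp add: admissible3_def admissible2_def)
  have "ext_deriv A \<omega>0 x ?X ?Y + (1/2) *\<^sub>R form_bracket br \<omega>0 \<omega>0 x ?X ?Y = - form_bracket br \<theta> \<omega>1 x ?X ?Y"
    using assms(1) x coord_vec_tangent[OF c x(1)] by (simp add: admissible3_def)
  moreover have "ext_deriv A \<omega>0 x ?X ?Y = local_ext_deriv A c \<omega>0 y \<xi> \<eta>"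
    using ext_deriv_chart[OF \<omega>0 open_U c x(1,2) coord_vec_tangent[OF c x(1)] coord_vec_tangent[OF c x(1)]]
      coord_vec_self[OF c x(1)] x(3) by simp
  \<comment> \<open>The two terms of the bracket of a form with itself coincide by antisymmetry,
    which absorbs the factor 1/2.\<close>
  moreover have "(1/2) *\<^sub>R form_bracket br \<omega>0 \<omega>0 x ?X ?Y = br (\<omega>0 x ?X) (\<omega>0 x ?Y)"
    using br_commute[of "\<omega>0 x ?Y" "\<omega>0 x ?X"]
    by (simp add: form_bracket_def flip: scaleR_2)
  ultimately show ?thesis
    using c x by (simp add: form_bracket_def local_form_def chart_inv_chart)
qed

section \<open>The total curvature in coordinates and the Bianchi identity\<close>

definition local_curvature where
  "local_curvature c \<omega>0 \<omega>1 y \<xi> \<eta> = local_ext_deriv A c \<omega>1 y \<xi> \<eta> +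
    (br (local_form A c \<omega>0 \<xi> y) (local_form A c \<omega>1 \<eta> y)
     - br (local_form A c \<omega>0 \<eta> y) (local_form A c \<omega>1 \<xi> y))"

context
  fixes \<omega>0 \<omega>1
  assumes admissible: "admissible3 A P U br \<hh> j (s, \<omega>0, \<omega>1)"
begin

lemma smooth_\<omega>0: "smooth_form1 A U (\<hh> 0) \<omega>0" and smooth_\<omega>1: "smooth_form1 A U (\<hh> 1) \<omega>1"
  using admissible by (simp_all add: admissible3_def admissible2_def)

lemma total_curvature_chart:
  assumes "c \<in> A" "x \<in> fst c" "x \<in> U" "X \<in> tangent_space A x" "Y \<in> tangent_space A x"
  shows "total_curvature A br \<omega>0 \<omega>1 x X Y = local_curvature c \<omega>0 \<omega>1 (snd c x) (X c) (Y c)"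
  using ext_deriv_chart[OF smooth_\<omega>1 open_U assms] assms
  by (simp add: total_curvature_def local_curvature_def form_bracket_def coord_form)

lemma bilinear_local_curvature:
  assumes "c \<in> A" "y \<in> snd c ` (fst c \<inter> U)"
  shows "bilinear (local_curvature c \<omega>0 \<omega>1 y)"
proof -
  note lin = linear_local_form[OF smooth_\<omega>0 assms] linear_local_form[OF smooth_\<omega>1 assms]
    linear_frechet_derivative_local_form[OF open_U smooth_\<omega>1 assms]
    linear_frechet_derivative[OF local_form_differentiable[OF smooth_\<omega>1 assms]]
  note add = lin[THEN linear_add] and cmul = lin[THEN linear_cmul]
  show ?thesis
    unfolding bilinear_def local_curvature_def local_ext_deriv_def
    by (intro conjI allI linearI) (simp_all add: add cmul br_simps algebra_simps)
qed

lemma local_curvature_self: "local_curvature c \<omega>0 \<omega>1 y \<xi> \<xi> = 0"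
  by (simp add: local_curvature_def local_ext_deriv_def)

lemma local_curvature_commute: "local_curvature c \<omega>0 \<omega>1 y \<xi> \<eta> = - local_curvature c \<omega>0 \<omega>1 y \<eta> \<xi>"
  by (simp add: local_curvature_def local_ext_deriv_def)

lemma local_curvature_grade:
  assumes "c \<in> A" "y \<in> snd c ` (fst c \<inter> U)"
  shows "local_curvature c \<omega>0 \<omega>1 y \<xi> \<eta> \<in> \<hh> 1"
proof -
  have "br (local_form A c \<omega>0 \<xi> y) (local_form A c \<omega>1 \<eta> y) \<in> \<hh> 1" for \<xi> \<eta>
    using br_grade[OF local_form_in_values[OF smooth_\<omega>0 assms] local_form_in_values[OF smooth_\<omega>1 assms]]
    by simp
  then show ?thesis
    unfolding local_curvature_def
    by (intro subspace_add subspace_diff subspace_grade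
        local_ext_deriv_in_values[OF subspace_grade smooth_\<omega>1 open_U assms])
qed

lemma smooth_on_local_curvature:
  assumes "c \<in> A"
  shows "smooth_on (snd c ` (fst c \<inter> U)) (\<lambda>y. local_curvature c \<omega>0 \<omega>1 y \<xi> \<eta>)"
  unfolding local_curvature_def local_ext_deriv_def
  by (intro smooth_on_add smooth_on_diff open_chart_image[OF assms open_U] smooth_on_frechet_derivative
      smooth_on_bounded_bilinear[OF _ bounded_bilinear_br] smooth_form1_smooth_on[OF smooth_\<omega>0 assms]
      smooth_form1_smooth_on[OF smooth_\<omega>1 assms])

text \<open>In a fixed chart the structure equation holds at every point of an open set, so both
  sides may be differentiated in the direction \<zeta>.\<close>

lemma structure_equation_derivative:
  fixes \<zeta> :: "real^'n"
  assumes c: "c \<in> A" and y: "y \<in> snd c ` (fst c \<inter> U)"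
  defines "t \<equiv> local_form A c \<theta>" and "a \<equiv> local_form A c \<omega>0" and "b \<equiv> local_form A c \<omega>1"
  shows "frechet_derivative (\<lambda>y. frechet_derivative (a \<eta>) (at y) \<xi>) (at y) \<zeta>
      - frechet_derivative (\<lambda>y. frechet_derivative (a \<xi>) (at y) \<eta>) (at y) \<zeta>
      + (br (a \<xi> y) (frechet_derivative (a \<eta>) (at y) \<zeta>) + br (frechet_derivative (a \<xi>) (at y) \<zeta>) (a \<eta> y)) =
    - ((br (t \<xi> y) (frechet_derivative (b \<eta>) (at y) \<zeta>) + br (frechet_derivative (t \<xi>) (at y) \<zeta>) (b \<eta> y))
      - (br (t \<eta> y) (frechet_derivative (b \<xi>) (at y) \<zeta>) + br (frechet_derivative (t \<eta>) (at y) \<zeta>) (b \<xi> y)))"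
proof -
  note S = open_chart_image[OF c open_U]
  note FD = bounded_bilinear.FDERIV[OF bounded_bilinear_br]
  have a: "(a \<xi> has_derivative frechet_derivative (a \<xi>) (at y)) (at y)"
    and b: "(b \<xi> has_derivative frechet_derivative (b \<xi>) (at y)) (at y)"
    and t: "(t \<xi> has_derivative frechet_derivative (t \<xi>) (at y)) (at y)" for \<xi>
    using local_form_differentiable[OF smooth_\<omega>0 c y] local_form_differentiable[OF smooth_\<omega>1 c y]
      differentiable_theta[OF c y]
    by (simp_all add: a_def b_def t_def frechet_derivative_works)
  have da: "((\<lambda>y. frechet_derivative (a \<eta>) (at y) \<xi>) has_derivative
      frechet_derivative (\<lambda>y. frechet_derivative (a \<eta>) (at y) \<xi>) (at y)) (at y)" for \<xi> \<eta>
    using smooth_on_imp_differentiable[OF smooth_on_frechet_derivative[OF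
        smooth_form1_smooth_on[OF smooth_\<omega>0 c]] y]
    by (simp add: a_def frechet_derivative_works)
  have eq: "frechet_derivative (a \<eta>) (at y) \<xi> - frechet_derivative (a \<xi>) (at y) \<eta> + br (a \<xi> y) (a \<eta> y) =
      - (br (t \<xi> y) (b \<eta> y) - br (t \<eta> y) (b \<xi> y))" if "y \<in> snd c ` (fst c \<inter> U)" for y
    using admissible3_local[OF admissible c that] by (simp add: local_ext_deriv_def a_def b_def t_def)
  note D1 = has_derivative_add[OF has_derivative_diff[OF da[of \<eta> \<xi>] da[of \<xi> \<eta>]] FD[OF a[of \<xi>] a[of \<eta>]]]
  note D2 = has_derivative_minus[OF has_derivative_diff[OF FD[OF t[of \<xi>] b[of \<eta>]] FD[OF t[of \<eta>] b[of \<xi>]]]]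
  show ?thesis
    using fun_cong[OF frechet_derivative_cong_open[OF S y eq, of "\<lambda>y. y"], of \<zeta>]
    unfolding frechet_derivative_eqI[OF D1] frechet_derivative_eqI[OF D2] .
qed

text \<open>The cyclic sum of the differentiated structure equation removes the second derivatives
  of \<omega>0. What remains of the derivative of \<theta> is its torsion, and the torsion equation
  is available in the chart chosen at x; hence this chart.\<close>

lemma bianchi:
  fixes e1 e2 e3 :: "real^'n"
  assumes x: "x \<in> U"
  defines "c \<equiv> chart_at A x"
  defines "y \<equiv> snd c x"
  shows "br (local_curvature c \<omega>0 \<omega>1 y e1 e2) (local_form A c \<theta> e3 y) +
    br (local_curvature c \<omega>0 \<omega>1 y e2 e3) (local_form A c \<theta> e1 y) +
    br (local_curvature c \<omega>0 \<omega>1 y e3 e1) (local_form A c \<theta> e2 y) = 0"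
proof -
  have c: "c \<in> A" "x \<in> fst c" by (simp_all add: c_def chart_at)
  have y: "y \<in> snd c ` (fst c \<inter> U)" using c x by (simp add: y_def)
  have adm2: "admissible2 A P U br \<hh> j (s, \<omega>0)"
    using admissible by (simp add: admissible3_def)
  \<comment> \<open>Numbering the three vectors makes the cyclic permutations instances of a single
    formula, in the shape required by \<open>bianchi_algebra\<close>.\<close>
  define e where "e = (\<lambda>i::nat. if i = 1 then e1 else if i = 2 then e2 else e3)"
  have e: "e 1 = e1" "e 2 = e2" "e 3 = e3" by (simp_all add: e_def)
  define t where "t i = local_form A c \<theta> (e i) y" for i
  define a where "a i = local_form A c \<omega>0 (e i) y" for i
  define b where "b i = local_form A c \<omega>1 (e i) y" for i
  define dt where "dt i k = frechet_derivative (local_form A c \<theta> (e i)) (at y) (e k)" for i k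
  define da where "da i k = frechet_derivative (local_form A c \<omega>0 (e i)) (at y) (e k)" for i k
  define db where "db i k = frechet_derivative (local_form A c \<omega>1 (e i)) (at y) (e k)" for i k
  define dda where "dda i k l = frechet_derivative (\<lambda>y. frechet_derivative (local_form A c \<omega>0 (e i)) (at y) (e k))
      (at y) (e l)" for i k l
  have E: "dda k i l - dda i k l + (br (a i) (da k l) + br (da i l) (a k)) =
      - ((br (t i) (db k l) + br (dt i l) (b k)) - (br (t k) (db i l) + br (dt k l) (b i)))" for i k l
    using structure_equation_derivative[OF c(1) y, of "e k" "e i" "e l"]
    by (simp only: dda_def a_def b_def t_def da_def db_def dt_def)
  have dda: "dda i k l = dda i l k" for i k l
    unfolding dda_def
    by (rule frechet_derivative_commute[OF open_chart_image[OF c(1) open_U] y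
          smooth_form1_smooth_on[OF smooth_\<omega>0 c(1)]])
  have A: "da k i - da i k + br (a i) (a k) = - (br (t i) (b k) - br (t k) (b i))" for i k
    using admissible3_local[OF admissible c(1) y, of "e i" "e k"]
    by (simp add: local_ext_deriv_def da_def a_def b_def t_def)
  have T: "dt k i - dt i k = - (br (t i) (a k) - br (t k) (a i))" for i k
    using admissible2_local[OF adm2 x, of "e i" "e k"]
    by (simp add: local_ext_deriv_def dt_def a_def t_def c_def y_def)
  \<comment> \<open>The sum of \<open>E\<close> over the cyclic permutations of 1, 2, 3; the second
    derivatives cancel in pairs by \<open>dda\<close>.\<close>
  have d: "br (da 2 1 - da 1 2) (a 3) + br (da 3 2 - da 2 3) (a 1) + br (da 1 3 - da 3 1) (a 2) =
      - (br (dt 2 1 - dt 1 2) (b 3) + br (dt 3 2 - dt 2 3) (b 1) + br (dt 1 3 - dt 3 1) (b 2) +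
        br (db 2 1 - db 1 2) (t 3) + br (db 3 2 - db 2 3) (t 1) + br (db 1 3 - db 3 1) (t 2))"
  proof (rule inner_eqI)
    fix z
    show "(br (da 2 1 - da 1 2) (a 3) + br (da 3 2 - da 2 3) (a 1) + br (da 1 3 - da 3 1) (a 2)) \<bullet> z =
      (- (br (dt 2 1 - dt 1 2) (b 3) + br (dt 3 2 - dt 2 3) (b 1) + br (dt 1 3 - dt 3 1) (b 2) +
        br (db 2 1 - db 1 2) (t 3) + br (db 3 2 - db 2 3) (t 1) + br (db 1 3 - db 3 1) (t 2))) \<bullet> z"
      using arg_cong[OF E[of 1 2 3], of "\<lambda>v. v \<bullet> z"] arg_cong[OF E[of 2 3 1], of "\<lambda>v. v \<bullet> z"]
        arg_cong[OF E[of 3 1 2], of "\<lambda>v. v \<bullet> z"]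
      by (simp add: dda[of 1 2 3] dda[of 2 3 1] dda[of 3 1 2] br_simps inner_simps
          br_commute[of "a _" "da _ _"] br_commute[of "t _" "db _ _"] del: One_nat_def)
  qed
  have "br (db 2 1 - db 1 2 + (br (a 1) (b 2) - br (a 2) (b 1))) (t 3) +
      br (db 3 2 - db 2 3 + (br (a 2) (b 3) - br (a 3) (b 2))) (t 1) +
      br (db 1 3 - db 3 1 + (br (a 3) (b 1) - br (a 1) (b 3))) (t 2) = 0"
    by (rule bianchi_algebra[where A = "\<lambda>i k. da k i - da i k" and T = "\<lambda>i k. dt k i - dt i k"
          and B = "\<lambda>i k. db k i - db i k", OF A A A T T T d])
  then show ?thesis
    by (simp only: local_curvature_def local_ext_deriv_def t_def a_def b_def db_def e)
qed

text \<open>On frame vectors \<theta> takes the values \<open>j w\<close>, so the cyclic sum in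
  \<open>bianchi\<close> becomes the coboundary up to sign.\<close>

lemma curvature_in_Z22:
  assumes x: "x \<in> U"
  shows "(\<lambda>w1 w2. total_curvature A br \<omega>0 \<omega>1 x (snd (s x) w1) (snd (s x) w2)) \<in> Z22 br \<hh> j"
proof -
  define c where "c = chart_at A x"
  have c: "c \<in> A" "x \<in> fst c" by (simp_all add: c_def chart_at)
  have y: "snd c x \<in> snd c ` (fst c \<inter> U)" using c x by simp
  let ?Q = "local_curvature c \<omega>0 \<omega>1 (snd c x)" and ?u = "\<lambda>w. snd (s x) w c"
  have eq: "total_curvature A br \<omega>0 \<omega>1 x (snd (s x) w1) (snd (s x) w2) = ?Q (?u w1) (?u w2)" for w1 w2
    by (rule total_curvature_chart[OF c x frame_tangent[OF x] frame_tangent[OF x]])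
  have Q: "bilinear ?Q" by (rule bilinear_local_curvature[OF c(1) y])
  have "bilinear (\<lambda>w1 w2. ?Q (?u w1) (?u w2))"
    using Q linear_frame[OF x, of c]
    by (auto simp: bilinear_def intro: linear_compose[unfolded o_def])
  moreover have "local_form A c \<theta> (?u w) (snd c x) = j w" for w
    using coord_form[OF c frame_tangent[OF x], of \<theta> w] theta_frame[OF x, of w] by simp
  then have "br (?Q (?u w1) (?u w2)) (j w3) + br (?Q (?u w2) (?u w3)) (j w1) +
      br (?Q (?u w3) (?u w1)) (j w2) = 0" for w1 w2 w3
    using bianchi[OF x, of "?u w1" "?u w2" "?u w3"] unfolding c_def by simp
  \<comment> \<open>The middle term of the coboundary has its arguments in the order w1, w3;
    antisymmetry restores the cyclic order.\<close>
  moreover have "coboundary br j (\<lambda>w1 w2. ?Q (?u w1) (?u w2)) w1 w2 w3 =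
      - (br (?Q (?u w1) (?u w2)) (j w3) + br (?Q (?u w2) (?u w3)) (j w1) +
        br (?Q (?u w3) (?u w1)) (j w2))" for w1 w2 w3
    using local_curvature_commute[of c "snd c x" "?u w1" "?u w3"]
    by (simp add: coboundary_def bilinear_lneg[OF bilinear_br])
  ultimately show ?thesis
    using local_curvature_self local_curvature_grade[OF c(1) y] by (simp add: Z22_def eq)
qed

lemma curvature_smooth: "curvature_map A U br (s, \<omega>0, \<omega>1) \<in> smooth_maps_to A U (Z22 br \<hh> j)"
proof -
  have "smooth_map_on U A eucl_atlas (\<lambda>x. curvature_map A U br (s, \<omega>0, \<omega>1) x w1 w2)" for w1 w2
  proof (rule smooth_map_on_euclI[OF open_U])
    fix c assume c: "c \<in> A"
    have S: "open (snd c ` (fst c \<inter> U))" by (rule open_chart_image[OF c open_U])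
    have "smooth_on (snd c ` (fst c \<inter> U)) (\<lambda>y. local_curvature c \<omega>0 \<omega>1 y
        (snd (s (chart_inv c y)) w1 c) (snd (s (chart_inv c y)) w2 c))"
      by (rule smooth_on_bilinear_family[OF S smooth_on_local_curvature[OF c]
            bilinear_local_curvature[OF c] smooth_on_frame_vector[OF c] smooth_on_frame_vector[OF c]])
    moreover have "((\<lambda>x. curvature_map A U br (s, \<omega>0, \<omega>1) x w1 w2) \<circ> chart_inv c) y =
        local_curvature c \<omega>0 \<omega>1 y (snd (s (chart_inv c y)) w1 c) (snd (s (chart_inv c y)) w2 c)"
      if y: "y \<in> snd c ` (fst c \<inter> U)" for y
    proof -
      obtain x where "x \<in> fst c" "x \<in> U" "y = snd c x" using y by blast
      then show ?thesis
        using total_curvature_chart[OF c _ _ frame_tangent frame_tangent, of x w1 w2] c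
        by (simp add: curvature_map_def chart_inv_chart)
    qed
    ultimately show "smooth_on (snd c ` (fst c \<inter> U))
        ((\<lambda>x. curvature_map A U br (s, \<omega>0, \<omega>1) x w1 w2) \<circ> chart_inv c)"
      using smooth_on_cong[OF S] by (metis (no_types, lifting))
  qed
  then show ?thesis
    using curvature_in_Z22 by (auto simp: smooth_maps_to_def curvature_map_def)
qed

end

section \<open>Gauge transformations of admissible tuples\<close>

lemma strongly_equivalent_sym:
  assumes s': "smooth_section A P U s'"
    and eq: "strongly_equivalent A U br \<hh> j (s, \<omega>0) (s', \<omega>0')"
  shows "strongly_equivalent A U br \<hh> j (s', \<omega>0') (s, \<omega>0)"
proof -
  obtain \<pi>1 where ss': "\<And>x. x \<in> U \<Longrightarrow> s x = s' x" and
    \<pi>1: "smooth_map_on U A eucl_atlas \<pi>1" "\<And>x. x \<in> U \<Longrightarrow> \<pi>1 x \<in> \<hh> 1" and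
    \<omega>0': "\<And>x X. x \<in> U \<Longrightarrow> X \<in> tangent_space A x \<Longrightarrow> \<omega>0' x X = \<omega>0 x X + br (\<theta> x X) (\<pi>1 x)"
    using eq unfolding strongly_equivalent_def by auto
  have "smooth_map_on U A eucl_atlas (\<lambda>x. - \<pi>1 x)"
    by (rule smooth_map_on_minus[OF open_U \<pi>1(1)])
  moreover have "- \<pi>1 x \<in> \<hh> 1" if "x \<in> U" for x
    using subspace_neg[OF subspace_grade \<pi>1(2)[OF that]] .
  moreover have "\<omega>0 x X = \<omega>0' x X + br (omega_minus A j s' x X) (- \<pi>1 x)"
    if "x \<in> U" "X \<in> tangent_space A x" for x X
    using \<omega>0'[OF that] omega_minus_section_cong[OF s' that(1) ss'[OF that(1)] that(2)]
    by (simp add: br_simps)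
  ultimately show ?thesis
    using ss' unfolding strongly_equivalent_def by auto
qed

lemma gauge_transformation:
  assumes adm: "admissible3 A P U br \<hh> j (s, \<omega>0, \<omega>1)"
    and adm': "admissible2 A P U br \<hh> j (s', \<omega>0')"
    and eq: "strongly_equivalent A U br \<hh> j (s, \<omega>0) (s', \<omega>0')"
  obtains \<omega>1' where "admissible3 A P U br \<hh> j (s', \<omega>0', \<omega>1')"
    "\<And>x X Y. x \<in> U \<Longrightarrow> X \<in> tangent_space A x \<Longrightarrow> Y \<in> tangent_space A x \<Longrightarrow>
      total_curvature A br \<omega>0' \<omega>1' x X Y = total_curvature A br \<omega>0 \<omega>1 x X Y"
proof -
  obtain \<pi>1 where ss': "\<And>x. x \<in> U \<Longrightarrow> s x = s' x" and
    \<pi>1: "smooth_map_on U A eucl_atlas \<pi>1" "\<And>x. x \<in> U \<Longrightarrow> \<pi>1 x \<in> \<hh> 1" and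
    \<omega>0'_eq: "\<And>x X. x \<in> U \<Longrightarrow> X \<in> tangent_space A x \<Longrightarrow> \<omega>0' x X = \<omega>0 x X + br (\<theta> x X) (\<pi>1 x)"
    using eq unfolding strongly_equivalent_def by auto
  have s': "smooth_section A P U s'" and \<omega>0': "smooth_form1 A U (\<hh> 0) \<omega>0'"
    using adm' by (simp_all add: admissible2_def)
  note \<omega>0 = smooth_\<omega>0[OF adm] and \<omega>1 = smooth_\<omega>1[OF adm]
  define D where "D = differential A \<pi>1"
  have D: "smooth_form1 A U (\<hh> 1) D"
    unfolding D_def by (rule smooth_form1_differential[OF \<pi>1(1) open_U subspace_grade \<pi>1(2)])
  define \<beta> where "\<beta> = (\<lambda>x X. \<omega>0 x X + \<omega>0' x X)"
  have \<beta>: "smooth_form1 A U (\<hh> 0) \<beta>"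
    unfolding \<beta>_def by (rule smooth_form1_add[OF subspace_grade open_U \<omega>0 \<omega>0'])
  define \<gamma> where "\<gamma> = (\<lambda>x X. br (\<beta> x X) (\<pi>1 x))"
  have \<gamma>: "smooth_form1 A U (\<hh> 1) \<gamma>"
    unfolding \<gamma>_def
    by (rule smooth_form1_bilinear[OF bounded_bilinear_br open_U \<beta> \<pi>1(1)])
      (use br_grade[of _ 0 _ 1] \<pi>1(2) in auto)
  \<comment> \<open>As \<omega>0' - \<omega>0 is the bracket of \<theta> with \<pi>1, half of
    \<gamma> equals [\<omega>0, \<pi>1] + 1/2 [[\<theta>, \<pi>1], \<pi>1], but is built from forms
    already known to be smooth.\<close>
  define \<omega>1' where "\<omega>1' = (\<lambda>x X. (\<omega>1 x X + D x X) + (1/2) *\<^sub>R \<gamma> x X)"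
  have \<omega>1': "smooth_form1 A U (\<hh> 1) \<omega>1'"
    unfolding \<omega>1'_def
    by (intro smooth_form1_add smooth_form1_scaleR subspace_grade open_U \<omega>1 D \<gamma>)
  have main: "ext_deriv A \<omega>0' x X Y + br (\<omega>0' x X) (\<omega>0' x Y) =
        - (br (\<theta> x X) (\<omega>1' x Y) - br (\<theta> x Y) (\<omega>1' x X))"
      "ext_deriv A \<omega>1' x X Y + (br (\<omega>0' x X) (\<omega>1' x Y) - br (\<omega>0' x Y) (\<omega>1' x X)) =
        ext_deriv A \<omega>1 x X Y + (br (\<omega>0 x X) (\<omega>1 x Y) - br (\<omega>0 x Y) (\<omega>1 x X))"
    if x: "x \<in> U" and X: "X \<in> tangent_space A x" and Y: "Y \<in> tangent_space A x" for x X Y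
  proof -
    define c where "c = chart_at A x"
    define y where "y = snd c x"
    have c: "c \<in> A" "x \<in> fst c" by (simp_all add: c_def chart_at)
    have y: "y \<in> snd c ` (fst c \<inter> U)" using c x by (simp add: y_def)
    have cy: "chart_inv c y = x" using c by (simp add: y_def chart_inv_chart)
    note dt = differentiable_theta[OF c(1) y] and da = local_form_differentiable[OF \<omega>0 c(1) y]
      and da' = local_form_differentiable[OF \<omega>0' c(1) y] and db = local_form_differentiable[OF \<omega>1 c(1) y]
      and dD = local_form_differentiable[OF D c(1) y] and dg = local_form_differentiable[OF \<gamma> c(1) y]
      and d\<beta> = local_form_differentiable[OF \<beta> c(1) y]
      and dp = smooth_on_imp_differentiable[OF smooth_map_on_euclD[OF \<pi>1(1) c(1)] y]
    note LX = coord_form[OF c X, folded y_def] and LY = coord_form[OF c Y, folded y_def]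
    \<comment> \<open>No smoothness of \<alpha> enters, because c is the very chart selected by
      \<open>ext_deriv\<close>; this covers \<theta>.\<close>
    have ext: "ext_deriv A \<alpha> x X Y = local_ext_deriv A c \<alpha> y (X c) (Y c)" for \<alpha> :: "('m, real^'n, 'l) form1"
      by (simp add: ext_deriv_eq_local c_def y_def)
    have Dx: "D x Z = frechet_derivative (\<pi>1 \<circ> chart_inv c) (at y) (Z c)" for Z
      by (simp add: D_def differential_def c_def y_def Let_def)
    \<comment> \<open>Leibniz rule for the defining relation of \<omega>0', which holds on all of U
      and can therefore be differentiated.\<close>
    have A': "ext_deriv A \<omega>0' x X Y = ext_deriv A \<omega>0 x X Y + br (ext_deriv A \<theta> x X Y) (\<pi>1 x)
        + br (\<theta> x Y) (D x X) - br (\<theta> x X) (D x Y)"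
    proof -
      have differentiable_bilinear: "local_form A c (\<lambda>x X. br (\<theta> x X) (\<pi>1 x)) \<zeta> differentiable (at y)" for \<zeta>
        using differentiable_bounded_bilinear[OF bounded_bilinear_br dt dp]
        by (simp add: local_form_def[abs_def] o_def)
      have "local_ext_deriv A c \<omega>0' y (X c) (Y c) =
          local_ext_deriv A c (\<lambda>x X. \<omega>0 x X + br (\<theta> x X) (\<pi>1 x)) y (X c) (Y c)"
        by (rule local_ext_deriv_cong[OF open_U c(1) y \<omega>0'_eq])
      also have "\<dots> = local_ext_deriv A c \<omega>0 y (X c) (Y c) +
          local_ext_deriv A c (\<lambda>x X. br (\<theta> x X) (\<pi>1 x)) y (X c) (Y c)"
        by (rule local_ext_deriv_add[OF da differentiable_bilinear])
      finally show ?thesis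
        unfolding local_ext_deriv_bilinear[OF bounded_bilinear_br dt dp] cy LX LY
        by (simp add: ext Dx)
    qed
    have B': "ext_deriv A \<omega>1' x X Y = ext_deriv A \<omega>1 x X Y + (1/2) *\<^sub>R
        (br (ext_deriv A \<omega>0 x X Y + ext_deriv A \<omega>0' x X Y) (\<pi>1 x)
          + br (\<omega>0 x Y + \<omega>0' x Y) (D x X) - br (\<omega>0 x X + \<omega>0' x X) (D x Y))"
    proof -
      have "local_form A c (\<lambda>x X. \<omega>1 x X + D x X) \<zeta> differentiable (at y)" for \<zeta>
        by (rule local_form_differentiable[OF smooth_form1_add[OF subspace_grade open_U \<omega>1 D] c(1) y])
      moreover have "local_form A c (\<lambda>x X. (1/2) *\<^sub>R \<gamma> x X) \<zeta> differentiable (at y)" for \<zeta>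
        by (rule local_form_differentiable[OF smooth_form1_scaleR[OF subspace_grade open_U \<gamma>] c(1) y])
      ultimately have "local_ext_deriv A c \<omega>1' y (X c) (Y c) =
          local_ext_deriv A c (\<lambda>x X. \<omega>1 x X + D x X) y (X c) (Y c) +
          local_ext_deriv A c (\<lambda>x X. (1/2) *\<^sub>R \<gamma> x X) y (X c) (Y c)"
        unfolding \<omega>1'_def by (rule local_ext_deriv_add)
      \<comment> \<open>\<open>D\<close> is the differential of \<pi>1 and contributes nothing, by d
        d = 0.\<close>
      also have "local_ext_deriv A c (\<lambda>x X. \<omega>1 x X + D x X) y (X c) (Y c) =
          local_ext_deriv A c \<omega>1 y (X c) (Y c)"
        using local_ext_deriv_differential[OF \<pi>1(1) open_U c(1) y]
        by (simp add: local_ext_deriv_add[OF db dD]) (simp add: D_def)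
      also have "local_ext_deriv A c (\<lambda>x X. (1/2) *\<^sub>R \<gamma> x X) y (X c) (Y c) =
          (1/2) *\<^sub>R local_ext_deriv A c \<gamma> y (X c) (Y c)"
        by (rule local_ext_deriv_scaleR[OF dg])
      also have "local_ext_deriv A c \<gamma> y (X c) (Y c) =
          br (local_ext_deriv A c \<beta> y (X c) (Y c)) (\<pi>1 x) + br (\<beta> x Y) (D x X) - br (\<beta> x X) (D x Y)"
        unfolding \<gamma>_def local_ext_deriv_bilinear[OF bounded_bilinear_br d\<beta> dp] cy LX LY Dx ..
      also have "local_ext_deriv A c \<beta> y (X c) (Y c) =
          local_ext_deriv A c \<omega>0 y (X c) (Y c) + local_ext_deriv A c \<omega>0' y (X c) (Y c)"
        unfolding \<beta>_def by (rule local_ext_deriv_add[OF da da'])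
      finally show ?thesis
        by (simp add: ext \<beta>_def)
    qed
    have T: "ext_deriv A \<theta> x X Y = - (br (\<theta> x X) (\<omega>0 x Y) - br (\<theta> x Y) (\<omega>0 x X))"
      using adm x X Y by (simp add: admissible3_def admissible2_def form_bracket_def)
    have A: "ext_deriv A \<omega>0 x X Y + br (\<omega>0 x X) (\<omega>0 x Y) = - (br (\<theta> x X) (\<omega>1 x Y) - br (\<theta> x Y) (\<omega>1 x X))"
      using admissible3_local[OF adm c(1) y, of "X c" "Y c"] unfolding LX LY by (simp add: ext)
    have b': "\<omega>1' x Z = \<omega>1 x Z + D x Z + (1/2) *\<^sub>R br (\<omega>0 x Z + \<omega>0' x Z) (\<pi>1 x)" for Z
      by (simp add: \<omega>1'_def \<gamma>_def \<beta>_def)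
    note gauge = theta_grade theta_grade smooth_form1_values[OF \<omega>0 x X] smooth_form1_values[OF \<omega>0 x Y]
      smooth_form1_values[OF \<omega>1 x X] smooth_form1_values[OF \<omega>1 x Y] \<pi>1(2)[OF x]
      smooth_form1_values[OF D x X] smooth_form1_values[OF D x Y] T A \<omega>0'_eq[OF x X] \<omega>0'_eq[OF x Y]
      b'[of X] b'[of Y] A'
    show "ext_deriv A \<omega>0' x X Y + br (\<omega>0' x X) (\<omega>0' x Y) =
        - (br (\<theta> x X) (\<omega>1' x Y) - br (\<theta> x Y) (\<omega>1' x X))"
      by (rule gauge_structure[OF gauge])
    show "ext_deriv A \<omega>1' x X Y + (br (\<omega>0' x X) (\<omega>1' x Y) - br (\<omega>0' x Y) (\<omega>1' x X)) =
        ext_deriv A \<omega>1 x X Y + (br (\<omega>0 x X) (\<omega>1 x Y) - br (\<omega>0 x Y) (\<omega>1 x X))"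
      by (rule gauge_curvature[OF gauge B'])
  qed
  show ?thesis
  proof
    show "admissible3 A P U br \<hh> j (s', \<omega>0', \<omega>1')"
      unfolding admissible3_def prod.case
    proof (intro conjI ballI adm' \<omega>1')
      fix x X Y assume xXY: "x \<in> U" "X \<in> tangent_space A x" "Y \<in> tangent_space A x"
      have "(1/2) *\<^sub>R form_bracket br \<omega>0' \<omega>0' x X Y = br (\<omega>0' x X) (\<omega>0' x Y)"
        using br_commute[of "\<omega>0' x Y" "\<omega>0' x X"] by (simp add: form_bracket_def flip: scaleR_2)
      \<comment> \<open>Admissibility of the new tuple involves the degree -1 form of s', which
        agrees with \<theta> over U.\<close>
      then show "ext_deriv A \<omega>0' x X Y + (1/2) *\<^sub>R form_bracket br \<omega>0' \<omega>0' x X Y =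
          - form_bracket br (omega_minus A j s') \<omega>1' x X Y"
        using main(1)[OF xXY] omega_minus_section_cong[OF s' xXY(1) ss'[OF xXY(1)]] xXY
        by (simp add: form_bracket_def)
    qed
    show "total_curvature A br \<omega>0' \<omega>1' x X Y = total_curvature A br \<omega>0 \<omega>1 x X Y"
      if "x \<in> U" "X \<in> tangent_space A x" "Y \<in> tangent_space A x" for x X Y
      using main(2)[OF that] by (simp add: total_curvature_def form_bracket_def)
  qed
qed

text \<open>The gauge transform of each extension has the same curvature. One inclusion is enough,
  since strong equivalence can be reversed by the opposite gauge function.\<close>

lemma curvature_image_subset:
  assumes adm': "admissible2 A P U br \<hh> j (s', \<omega>0')"
    and eq: "strongly_equivalent A U br \<hh> j (s, \<omega>0) (s', \<omega>0')"
  shows "curvature_map A U br ` admissible_extensions A P U br \<hh> j s \<omega>0 \<subseteq>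
    curvature_map A U br ` admissible_extensions A P U br \<hh> j s' \<omega>0'"
proof
  fix R assume "R \<in> curvature_map A U br ` admissible_extensions A P U br \<hh> j s \<omega>0"
  then obtain \<omega>1 where R: "R = curvature_map A U br (s, \<omega>0, \<omega>1)"
    and adm: "admissible3 A P U br \<hh> j (s, \<omega>0, \<omega>1)"
    by (auto simp: admissible_extensions_def)
  obtain \<omega>1' where adm3': "admissible3 A P U br \<hh> j (s', \<omega>0', \<omega>1')" and
    curv: "\<And>x X Y. x \<in> U \<Longrightarrow> X \<in> tangent_space A x \<Longrightarrow> Y \<in> tangent_space A x \<Longrightarrow>
      total_curvature A br \<omega>0' \<omega>1' x X Y = total_curvature A br \<omega>0 \<omega>1 x X Y"
    using gauge_transformation[OF adm adm' eq] by blast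
  have "\<And>x. x \<in> U \<Longrightarrow> s' x = s x"
    using eq by (simp add: strongly_equivalent_def)
  \<comment> \<open>Outside U both restricted maps are \<open>undefined\<close>; over U the frames
    agree and frame vectors are tangent, so \<open>curv\<close> applies.\<close>
  then have "curvature_map A U br (s', \<omega>0', \<omega>1') = R"
    unfolding R curvature_map_def prod.case
    by (intro restrict_ext ext) (simp add: curv frame_tangent)
  moreover have "(s', \<omega>0', \<omega>1') \<in> admissible_extensions A P U br \<hh> j s' \<omega>0'"
    using adm3' by (simp add: admissible_extensions_def)
  ultimately show "R \<in> curvature_map A U br ` admissible_extensions A P U br \<hh> j s' \<omega>0'"
    by (metis imageI)
qed

lemma curvature_map_funcset:
  "curvature_map A U br \<in> admissible_extensions A P U br \<hh> j s \<omega>0 \<rightarrow> smooth_maps_to A U (Z22 br \<hh> j)"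
  using curvature_smooth by (auto simp: admissible_extensions_def)

end

lemma linear_pad: "linear (pad \<iota>)"
  by (intro linearI) (auto simp: pad_def vec_eq_iff)

theorem proposition4p2:
  fixes H :: "'h::{t2_space,second_countable_topology} monoid"
    and AH :: "('h, 'd::euclidean_space) chart set"
    and br :: "'l::euclidean_space \<Rightarrow> 'l \<Rightarrow> 'l"
    and \<Lambda> :: "'l \<Rightarrow> 'h \<Rightarrow> ('h, 'd) tvec"
    and \<hh> :: "int \<Rightarrow> 'l set"
    and B :: "('p::{t2_space,second_countable_topology}, real^'N::finite) chart set"
    and act :: "'h \<Rightarrow> 'p \<Rightarrow> 'p" and p :: 'p and K :: "'h set"
    and u\<^sub>o :: "('p, 'N) frame" and \<phi> :: "real^'N \<Rightarrow> 'l"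
    and Gt :: "(real^'N^'N) set" and Pt :: "('p \<times> ('p, 'N) frame) set"
    and \<iota> :: "'n::finite \<Rightarrow> 'N"
    and A :: "('m::{t2_space,second_countable_topology}, real^'n) chart set"
    and G :: "(real^'n^'n) set" and P :: "('m \<times> ('m, 'n) frame) set"
    and U :: "'m set"
    and s s' :: "'m \<Rightarrow> 'm \<times> ('m, 'n) frame"
    and \<omega>0 \<omega>0' :: "('m, real^'n, 'l) form1"
    and j :: "real^'n \<Rightarrow> 'l"
  assumes "flat_2_reductive H AH br \<Lambda> \<hh> B act p K u\<^sub>o \<phi> Gt Pt"
    and "inj \<iota>"
    and "j = \<phi> \<circ> pad \<iota>"
    and "smooth_manifold A"
    and "g_structure A G P"
    and "G = upper_left \<iota> ` G_sharp \<iota> Gt"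
    and "open U"
    and "admissible2 A P U br \<hh> j (s, \<omega>0)"
    and "admissible2 A P U br \<hh> j (s', \<omega>0')"
    and "strongly_equivalent A U br \<hh> j (s, \<omega>0) (s', \<omega>0')"
  shows "curvature_map A U br \<in>
           admissible_extensions A P U br \<hh> j s \<omega>0 \<rightarrow> smooth_maps_to A U (Z22 br \<hh> j) \<and>
         curvature_map A U br \<in>
           admissible_extensions A P U br \<hh> j s' \<omega>0' \<rightarrow> smooth_maps_to A U (Z22 br \<hh> j) \<and>
         curvature_map A U br ` admissible_extensions A P U br \<hh> j s \<omega>0 =
           curvature_map A U br ` admissible_extensions A P U br \<hh> j s' \<omega>0'"
proof -
  have lie: "lie_algebra br" "graded_lie_algebra br \<hh>" and
    \<phi>: "linear \<phi>" "bij_betw \<phi> UNIV (\<hh> (-1))"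
    using assms(1) by (simp_all add: flat_2_reductive_def is_lie_algebra_of_def frame_identification_def)
  have j: "linear j" "\<And>w. j w \<in> \<hh> (-1)"
    unfolding assms(3) using linear_compose[OF linear_pad \<phi>(1)] \<phi>(2) by (auto simp: bij_betw_def)
  have P: "P \<subseteq> frame_bundle A"
    using assms(5) by (simp add: g_structure_def)
  have s: "smooth_section A P U s" "smooth_section A P U s'"
    using assms(8,9) by (simp_all add: admissible2_def)
  interpret S: admissible_frame A P U s br \<hh> j
    by unfold_locales (fact assms lie j(2) P s linear_add[OF j(1)] linear_cmul[OF j(1)])+
  interpret S': admissible_frame A P U s' br \<hh> j
    by unfold_locales (fact assms lie j(2) P s linear_add[OF j(1)] linear_cmul[OF j(1)])+
  \<comment> \<open>The reverse inclusion is the same lemma for the tuple based on s', with strong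
    equivalence turned around.\<close>
  show ?thesis
    using S.curvature_map_funcset S'.curvature_map_funcset
      S.curvature_image_subset[OF assms(9,10)]
      S'.curvature_image_subset[OF assms(8) S.strongly_equivalent_sym[OF s(2) assms(10)]]
    by blast
qed

end
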